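(* Let $R=k[x_1,\ldots,x_d]$, $d\ge 2$, be a polynomial ring over a field $k$ with its standard grading, and let $M$ be a nonzero finitely generated graded $R$-module generated in degree $0$ (i.e. $M$ is generated by its homogeneous elements of degree $0$). If $M$ is torsion-free, then $M$ is a free $R$-module if and only if $e_1(M)=0$.
   Context: For a finitely generated graded module $M$ of dimension $d$ over $R=k[x_1,\dots,x_d]$ (each $x_i$ of degree $1$), the Hilbert coefficients $e_i(M)$, $0\le i\le d$, of the native grading of $M$ are the integers determined by $$\sum_{j\le n}\dim_k M_j=\sum_{i=0}^{d}(-1)^i e_i(M)\binom{n+d-i}{d-i}\qquad\text{for all } n\gg 0,$$ where $M_j$ is the degree-$j$ component of $M$. *)

theory Defs
  imports Complex_Main "HOL-Library.Cardinality" "HOL-Library.Poly_Mapping"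
begin

text \<open>
  The polynomial ring \<open>k[x\<^sub>1,\<dots>,x\<^sub>d]\<close> is the monoid algebra of finitely supported functions from
  exponent vectors to coefficients. The variables are indexed by a finite type, so
  \<open>d = CARD('n)\<close>.
\<close>

type_synonym ('n, 'k) polynomial = "('n \<Rightarrow>\<^sub>0 nat) \<Rightarrow>\<^sub>0 'k"

definition total_degree :: "('n::finite \<Rightarrow>\<^sub>0 nat) \<Rightarrow> nat" where
  "total_degree m = (\<Sum>v\<in>UNIV. Poly_Mapping.lookup m v)"

definition homogeneous_part :: "nat \<Rightarrow> ('n::finite, 'k::zero) polynomial set" where
  "homogeneous_part i = {p. \<forall>m\<in>Poly_Mapping.keys p. total_degree m = i}"

abbreviation const_poly :: "'k::zero \<Rightarrow> ('n::finite, 'k) polynomial" where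
  "const_poly c \<equiv> Poly_Mapping.single 0 c"

context module
begin

definition finitely_generated :: bool where
  "finitely_generated \<longleftrightarrow> (\<exists>S. finite S \<and> span S = UNIV)"

definition torsion_free :: bool where
  "torsion_free \<longleftrightarrow> (\<forall>r x. r *s x = 0 \<longrightarrow> r = 0 \<or> x = 0)"

definition free :: bool where
  "free \<longleftrightarrow> (\<exists>B. independent B \<and> span B = UNIV)"

end

text \<open>
  A graded module over the standard graded polynomial ring: the module is the whole type \<open>'m\<close>, and
  \<open>G j\<close> is its component of degree \<open>j \<in> \<int>\<close>.
\<close>

locale graded_module = module scale
  for scale :: "('n::finite, 'k::field) polynomial \<Rightarrow> 'm::ab_group_add \<Rightarrow> 'm"  (infixr \<open>*s\<close> 75) +
  fixes G :: "int \<Rightarrow> 'm set"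
  assumes zero_component: "0 \<in> G j"
    and diff_component: "x \<in> G j \<Longrightarrow> y \<in> G j \<Longrightarrow> x - y \<in> G j"
    and scale_component: "p \<in> homogeneous_part i \<Longrightarrow> x \<in> G j \<Longrightarrow> p *s x \<in> G (int i + j)"
    and direct_sum: "\<exists>!c. (\<forall>j. c j \<in> G j) \<and> finite {j. c j \<noteq> 0} \<and> x = (\<Sum>j | c j \<noteq> 0. c j)"
begin

sublocale kspace: vector_space "\<lambda>c x. const_poly c *s x"
  by unfold_locales
    (simp_all add: scale_right_distrib scale_left_distrib single_add mult_single)

text \<open>
  For a finitely generated module every \<open>G j\<close> is finite-dimensional and only finitely many \<open>j \<le> n\<close>
  contribute. The summation is restricted to these because \<^const>\<open>sum\<close> vanishes on infinite
  index sets.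
\<close>

definition cumulative_hilbert :: "nat \<Rightarrow> nat" where
  "cumulative_hilbert n = (\<Sum>j | j \<le> int n \<and> G j \<noteq> {0}. kspace.dim (G j))"

definition is_hilbert_coeffs :: "(nat \<Rightarrow> int) \<Rightarrow> bool" where
  "is_hilbert_coeffs e \<longleftrightarrow>
     (\<forall>\<^sub>F n in sequentially. int (cumulative_hilbert n) =
        (\<Sum>i\<le>CARD('n). (- 1) ^ i * e i * int ((n + (CARD('n) - i)) choose (CARD('n) - i))))"

text \<open>
  Only \<open>e\<^sub>0,\<dots>,e\<^sub>d\<close> occur in the defining formula; the remaining values are set to \<open>0\<close> to make
  the sequence unique.
\<close>

definition hilbert_coeff :: "nat \<Rightarrow> int" where
  "hilbert_coeff = (THE e. is_hilbert_coeffs e \<and> (\<forall>i>CARD('n). e i = 0))"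

end

end

theory Submission
  imports Defs "HOL-Library.FuncSet"
begin

text \<open>
  Let \<open>E\<close> be a \<open>k\<close>-basis of the degree 0 component and \<open>B \<subseteq> E\<close> a maximal \<open>R\<close>-independent subset, with
  span \<open>F\<close>. Some nonzero polynomial multiplies the module into \<open>F\<close>, so the cumulative Hilbert
  function differs from that of \<open>F\<close> only in lower order and \<open>e\<^sub>0 = card B\<close>. If some \<open>y \<in> E\<close> is not
  in \<open>F\<close>, consider the ideal \<open>J\<close> of all polynomials \<open>s\<close> with \<open>s y \<in> F\<close>. If \<open>J\<close> contained, for each
  variable, a nonzero polynomial free of that variable, then \<open>J\<close> would be the unit ideal: along with \<open>t\<close>
  it contains a power of the leading part of \<open>t\<close> with respect to any variable, hence a monomial, and
  the variables can then be cancelled from this monomial one at a time. So \<open>J\<close> meets the polynomials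
  free of some variable trivially, and their multiples of \<open>y\<close> contribute a term of order
  \<open>n\<^sup>d\<^sup>-\<^sup>1\<close> on top of \<open>F\<close>, that is, \<open>e\<^sub>1 < 0\<close>. Conversely, a basis of a free module has as many elements
  as \<open>E\<close> by comparing constant terms and growth, which forces \<open>B = E\<close>.
\<close>

section \<open>Integer combinations of binomial coefficients\<close>

text \<open>\<open>hilbert_coeff\<close> is a definite description, so nothing can be read off it
  before some sequence is known to satisfy the defining formula and to be the only one. Existence
  for a general module is the Hilbert polynomial theorem, obtained here by counting standard
  monomials; it is the reason for the combinatorics of exponent vectors. In the basis
  \<open>(n + j) choose j\<close> the coefficient at \<open>j = d - 1\<close> is minus the first
  Hilbert coefficient, so the surplus term must make it positive.

  The argument about J replaces unique factorisation. In a factorial ring a nonzero J is principal,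
  generated by the common denominator of the coordinates of y over F; a nonunit generator involves
  some variable, and none of its nonzero multiples is free of that variable. Leading parts reach the
  same conclusion by cancelling nonzero polynomials and comparing exponents of one variable at a
  time.\<close>

definition binomial_type :: "nat \<Rightarrow> (nat \<Rightarrow> int) \<Rightarrow> bool" where
  "binomial_type d f \<longleftrightarrow>
     (\<exists>c. \<forall>\<^sub>F n in sequentially. f n = (\<Sum>j\<le>d. c j * int ((n + j) choose j)))"

lemma binomial_type_cong:
  assumes "\<forall>\<^sub>F n in sequentially. f n = g n" and "binomial_type d f"
  shows "binomial_type d g"
proof -
  obtain c where "\<forall>\<^sub>F n in sequentially. f n = (\<Sum>j\<le>d. c j * int ((n + j) choose j))"
    using assms(2) by (auto simp: binomial_type_def)
  with assms(1) have "\<forall>\<^sub>F n in sequentially. g n = (\<Sum>j\<le>d. c j * int ((n + j) choose j))"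
    by eventually_elim simp
  then show ?thesis by (auto simp: binomial_type_def)
qed

lemma binomial_type_add:
  assumes "binomial_type d f" and "binomial_type d g"
  shows "binomial_type d (\<lambda>n. f n + g n)"
proof -
  obtain a b where
      "\<forall>\<^sub>F n in sequentially. f n = (\<Sum>j\<le>d. a j * int ((n + j) choose j))"
      "\<forall>\<^sub>F n in sequentially. g n = (\<Sum>j\<le>d. b j * int ((n + j) choose j))"
    using assms by (auto simp: binomial_type_def)
  then have "\<forall>\<^sub>F n in sequentially.
      f n + g n = (\<Sum>j\<le>d. (a j + b j) * int ((n + j) choose j))"
    by eventually_elim (simp add: sum.distrib distrib_right)
  then show ?thesis
    unfolding binomial_type_def by (intro exI[of _ "\<lambda>j. a j + b j"])
qed

lemma binomial_type_cmult:
  assumes "binomial_type d f"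
  shows "binomial_type d (\<lambda>n. a * f n)"
proof -
  obtain c where "\<forall>\<^sub>F n in sequentially. f n = (\<Sum>j\<le>d. c j * int ((n + j) choose j))"
    using assms by (auto simp: binomial_type_def)
  then have "\<forall>\<^sub>F n in sequentially. a * f n = (\<Sum>j\<le>d. (a * c j) * int ((n + j) choose j))"
    by eventually_elim (simp add: sum_distrib_left mult.assoc)
  then show ?thesis unfolding binomial_type_def by (intro exI)
qed

lemma binomial_type_choose:
  assumes "j \<le> d"
  shows "binomial_type d (\<lambda>n. int ((n + j) choose j))"
proof -
  have "int ((n + j) choose j) = (\<Sum>i\<le>d. (if i = j then 1 else 0) * int ((n + i) choose i))" for n
    using assms by (simp add: if_distrib[of "\<lambda>x. x * _"] cong: if_cong)
  then show ?thesis
    unfolding binomial_type_def by (intro exI[of _ "\<lambda>i. if i = j then 1 else 0"] always_eventually allI)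
qed

lemma binomial_type_0: "binomial_type d (\<lambda>n. 0)"
  using binomial_type_cmult[OF binomial_type_choose[of 0 d], of 0] by simp

lemma binomial_type_const: "binomial_type d (\<lambda>n. a)"
  using binomial_type_cmult[OF binomial_type_choose[of 0 d], of a] by simp

lemma binomial_type_sum:
  assumes "\<And>i. i \<in> I \<Longrightarrow> binomial_type d (f i)"
  shows "binomial_type d (\<lambda>n. \<Sum>i\<in>I. f i n)"
  using assms
  by (induction I rule: infinite_finite_induct) (auto intro: binomial_type_0 binomial_type_add)

lemma binomial_type_mono:
  assumes "binomial_type d f" and "d \<le> d'"
  shows "binomial_type d' f"
proof -
  obtain c where "\<forall>\<^sub>F n in sequentially. f n = (\<Sum>j\<le>d. c j * int ((n + j) choose j))"
    using assms(1) by (auto simp: binomial_type_def)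
  then have "\<forall>\<^sub>F n in sequentially. (\<Sum>j\<le>d. c j * int ((n + j) choose j)) = f n"
    by eventually_elim simp
  then show ?thesis
    by (rule binomial_type_cong)
      (intro binomial_type_sum binomial_type_cmult binomial_type_choose;
        use assms(2) in simp)
qed

text \<open>Pascal's rule turns a basis function at the predecessor of \<open>n\<close> into a
  difference of two basis functions at \<open>n\<close>. Truncated subtraction matters only at
  \<open>n = 0\<close>, which an eventual statement ignores.\<close>

lemma binomial_type_pred:
  assumes "binomial_type d f"
  shows "binomial_type d (\<lambda>n. f (n - 1))"
proof -
  obtain c where c: "\<forall>\<^sub>F n in sequentially. f n = (\<Sum>j\<le>d. c j * int ((n + j) choose j))"
    using assms by (auto simp: binomial_type_def)
  have basis: "binomial_type d (\<lambda>n. int ((n - 1 + j) choose j))" if "j \<le> d" for j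
  proof (cases j)
    case 0
    then show ?thesis by (simp add: binomial_type_const)
  next
    case (Suc i)
    have "binomial_type d (\<lambda>n. int ((n + j) choose j) + (- 1) * int ((n + i) choose i))"
      using that Suc
      by (intro binomial_type_add binomial_type_cmult binomial_type_choose) auto
    moreover have "\<forall>\<^sub>F n in sequentially.
        int ((n + j) choose j) + (- 1) * int ((n + i) choose i) = int ((n - 1 + j) choose j)"
      using eventually_gt_at_top[of 0]
    proof eventually_elim
      case (elim n)
      then obtain m where "n = Suc m" by (cases n) auto
      then show ?case using Suc by simp
    qed
    ultimately show ?thesis by (rule binomial_type_cong[rotated])
  qed
  have "\<forall>\<^sub>F n in sequentially. (\<Sum>j\<le>d. c j * int ((n - 1 + j) choose j)) = f (n - 1)"
    using c unfolding eventually_sequentially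
  proof (elim exE)
    fix N assume N: "\<forall>n\<ge>N. f n = (\<Sum>j\<le>d. c j * int ((n + j) choose j))"
    show "\<exists>N. \<forall>n\<ge>N. (\<Sum>j\<le>d. c j * int ((n - 1 + j) choose j)) = f (n - 1)"
      using N by (intro exI[of _ "Suc N"]) auto
  qed
  then show ?thesis
    by (rule binomial_type_cong) (intro binomial_type_sum binomial_type_cmult basis; simp)
qed

lemma binomial_type_shift:
  "binomial_type d f \<Longrightarrow> binomial_type d (\<lambda>n. f (n - k))"
proof (induction k)
  case (Suc k)
  then show ?case using binomial_type_pred[of d "\<lambda>n. f (n - k)"] by simp
qed simp

lemma sum_choose_add_atMost: "(\<Sum>k\<le>n. (k + j) choose j) = (n + Suc j) choose Suc j"
  by (induction n) simp_all

text \<open>The hockey-stick identity raises the index of every basis function by one. The finitely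
  many early values where \<open>f\<close> departs from its formula contribute a constant, a
  multiple of the basis function of index 0.\<close>

lemma binomial_type_cumulative:
  assumes "binomial_type d f"
  shows "binomial_type (Suc d) (\<lambda>n. \<Sum>k\<le>n. f k)"
proof -
  obtain c N where c: "\<And>n. n \<ge> N \<Longrightarrow> f n = (\<Sum>j\<le>d. c j * int ((n + j) choose j))"
    using assms by (auto simp: binomial_type_def eventually_sequentially)
  define g where "g n = (\<Sum>j\<le>d. c j * int ((n + j) choose j))" for n
  define a where "a = (\<Sum>k<N. f k - g k)"
  have "(\<Sum>k\<le>n. f k) = (\<Sum>j\<le>d. c j * int ((n + Suc j) choose Suc j)) + a" if "n \<ge> N" for n
  proof -
    have "(\<Sum>k\<le>n. f k - g k) = (\<Sum>k<N. f k - g k)"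
      using that c by (intro sum.mono_neutral_right) (auto simp: g_def)
    moreover have "(\<Sum>k\<le>n. g k) = (\<Sum>j\<le>d. c j * int ((n + Suc j) choose Suc j))"
      unfolding g_def
      by (subst sum.swap) (simp only: sum_distrib_left[symmetric] of_nat_sum[symmetric] sum_choose_add_atMost)
    ultimately show ?thesis by (simp add: a_def sum_subtractf)
  qed
  then have "\<forall>\<^sub>F n in sequentially.
      (\<Sum>j\<le>d. c j * int ((n + Suc j) choose Suc j)) + a = (\<Sum>k\<le>n. f k)"
    unfolding eventually_sequentially by metis
  then show ?thesis
    by (rule binomial_type_cong)
      (intro binomial_type_add binomial_type_sum binomial_type_cmult binomial_type_choose
        binomial_type_const; simp)
qed

section \<open>Asymptotic comparison of binomial combinations\<close>

lemma const_over_shift_tendsto_0: "(\<lambda>n. a / (real n + b)) \<longlonglongrightarrow> 0"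
proof -
  have "filterlim (\<lambda>n. b + real n) at_top sequentially"
    by (rule filterlim_tendsto_add_at_top[OF tendsto_const filterlim_real_sequentially])
  then show ?thesis
    by (intro tendsto_divide_0[OF tendsto_const] filterlim_at_top_imp_at_infinity)
      (simp add: add.commute)
qed

lemma Suc_times_choose_add:
  "real (Suc d) * real ((m + Suc d) choose Suc d) =
    (real m + real (Suc d)) * real ((m + d) choose d)"
proof -
  have "Suc d * ((m + Suc d) choose Suc d) = (m + Suc d) * ((m + d) choose d)"
    using Suc_times_binomial[of d "m + d"] by (simp only: add_Suc_right)
  then show ?thesis
    by (metis of_nat_add of_nat_mult)
qed

text \<open>Raising \<open>d\<close> by one multiplies the ratio by
  \<open>1 + K / (n + d + 1)\<close>, which tends to 1. Bounds that differ by a constant shift of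
  the argument therefore still determine a leading coefficient.\<close>

lemma choose_ratio_tendsto_1:
  "(\<lambda>n. real ((n + K + d) choose d) / real ((n + d) choose d)) \<longlonglongrightarrow> 1"
proof (induction d)
  case (Suc d)
  have "(\<lambda>n. 1 + real K / (real n + real (Suc d))) \<longlonglongrightarrow> 1 + 0"
    by (intro tendsto_add tendsto_const const_over_shift_tendsto_0)
  then have "(\<lambda>n. real ((n + K + d) choose d) / real ((n + d) choose d) *
      (1 + real K / (real n + real (Suc d)))) \<longlonglongrightarrow> 1 * 1"
    using Suc by (intro tendsto_mult) auto
  moreover have "real ((n + K + Suc d) choose Suc d) / real ((n + Suc d) choose Suc d) =
      real ((n + K + d) choose d) / real ((n + d) choose d) *
      (1 + real K / (real n + real (Suc d)))" for n
  proof -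
    have "real ((m + Suc d) choose Suc d) =
        (real m + real (Suc d)) * real ((m + d) choose d) / real (Suc d)" for m
      using Suc_times_choose_add[of d m] by (simp add: field_simps del: of_nat_Suc binomial_Suc_Suc)
    note ** = this
    have "((n + d) choose d) \<noteq> 0" by (simp add: binomial_eq_0_iff)
    then have "real ((n + d) choose d) > 0" by simp
    moreover have "real n + real (Suc d) > 0" by simp
    moreover have "(u + K) * a / s / (u * b / s) = a / b * (1 + K / u)"
      if "b > 0" "u > 0" "s > 0" for a b s u K :: real
      using that by (simp add: field_simps)
    from this[of _ "real n + real (Suc d)" "real (Suc d)" "real K"]
    have "(real (n + K) + real (Suc d)) * a / real (Suc d) /
        ((real n + real (Suc d)) * b / real (Suc d)) =
        a / b * (1 + real K / (real n + real (Suc d)))" if "b > 0" for a b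
      using that by (simp add: add_ac)
    ultimately show ?thesis
      unfolding **[of n] **[of "n + K"] by (simp del: of_nat_Suc)
  qed
  ultimately show ?case by simp
qed simp

lemma choose_ratio_tendsto_0:
  assumes "j < d"
  shows "(\<lambda>n. real ((n + j) choose j) / real ((n + d) choose d)) \<longlonglongrightarrow> 0"
  using assms
proof (induction d)
  case (Suc d)
  have lim0: "(\<lambda>n. real (Suc d) / (real n + real (Suc d))) \<longlonglongrightarrow> 0"
    by (rule const_over_shift_tendsto_0)
  have eq: "real ((n + j) choose j) / real ((n + Suc d) choose Suc d) =
      real ((n + j) choose j) / real ((n + d) choose d) * (real (Suc d) / (real n + real (Suc d)))" for n
  proof -
    have "real ((n + Suc d) choose Suc d) =
        (real n + real (Suc d)) * real ((n + d) choose d) / real (Suc d)"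
      using Suc_times_choose_add[of d n] by (simp add: field_simps del: of_nat_Suc binomial_Suc_Suc)
    then show ?thesis by simp
  qed
  show ?case
  proof (cases "j = d")
    case True
    have "real ((n + d) choose d) / real ((n + d) choose d) = 1" for n
      by (simp add: binomial_eq_0_iff)
    then show ?thesis unfolding eq using True lim0 by simp
  next
    case False
    then have "j < d" using Suc.prems by simp
    then show ?thesis unfolding eq using tendsto_mult[OF Suc.IH lim0] by simp
  qed
qed simp

text \<open>Stated for any index \<open>J\<close> above which the coefficients vanish, since
  uniqueness needs it at the largest index where two combinations differ, which may lie below
  \<open>d\<close>.\<close>

lemma binomial_sum_ratio_tendsto:
  fixes c :: "nat \<Rightarrow> int"
  assumes "J \<le> d" and "\<And>j. J < j \<Longrightarrow> j \<le> d \<Longrightarrow> c j = 0"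
  shows "(\<lambda>n. real_of_int (\<Sum>j\<le>d. c j * int ((n + j) choose j)) / real ((n + J) choose J))
    \<longlonglongrightarrow> real_of_int (c J)"
proof -
  have "(\<lambda>n. (\<Sum>j<J. real_of_int (c j) * (real ((n + j) choose j) / real ((n + J) choose J))) + c J)
      \<longlonglongrightarrow> (\<Sum>j<J. real_of_int (c j) * 0) + c J"
    by (intro tendsto_add tendsto_sum tendsto_mult tendsto_const choose_ratio_tendsto_0) auto
  moreover have "real_of_int (\<Sum>j\<le>d. c j * int ((n + j) choose j)) / real ((n + J) choose J) =
      (\<Sum>j<J. real_of_int (c j) * (real ((n + j) choose j) / real ((n + J) choose J))) + c J" for n
  proof -
    have "(\<Sum>j\<le>d. c j * int ((n + j) choose j)) = (\<Sum>j\<le>J. c j * int ((n + j) choose j))"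
      using assms by (intro sum.mono_neutral_right) auto
    also have "\<dots> = (\<Sum>j<J. c j * int ((n + j) choose j)) + c J * int ((n + J) choose J)"
      by (simp flip: lessThan_Suc_atMost)
    finally show ?thesis
      by (simp add: add_divide_distrib sum_divide_distrib binomial_eq_0_iff)
  qed
  ultimately show ?thesis by simp
qed

lemma binomial_sum_unique:
  fixes c c' :: "nat \<Rightarrow> int"
  assumes "\<forall>\<^sub>F n in sequentially. (\<Sum>j\<le>d. c j * int ((n + j) choose j)) =
      (\<Sum>j\<le>d. c' j * int ((n + j) choose j))"
    and "j \<le> d"
  shows "c j = c' j"
proof (rule ccontr)
  assume ne: "c j \<noteq> c' j"
  define J where "J = Max {j. j \<le> d \<and> c j \<noteq> c' j}"
  have "J \<in> {j. j \<le> d \<and> c j \<noteq> c' j}"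
    unfolding J_def using ne assms(2) by (intro Max_in) auto
  then have J: "J \<le> d" "c J \<noteq> c' J" by auto
  have "c i - c' i = 0" if "J < i" "i \<le> d" for i
  proof (rule ccontr)
    assume "c i - c' i \<noteq> 0"
    then have "i \<le> J"
      unfolding J_def using that by (intro Max_ge) auto
    with that show False by simp
  qed
  then have "(\<lambda>n. real_of_int (\<Sum>j\<le>d. (c j - c' j) * int ((n + j) choose j)) / real ((n + J) choose J))
    \<longlonglongrightarrow> real_of_int (c J - c' J)"
    using J(1) by (intro binomial_sum_ratio_tendsto) auto
  moreover have "\<forall>\<^sub>F n in sequentially.
      real_of_int (\<Sum>j\<le>d. (c j - c' j) * int ((n + j) choose j)) / real ((n + J) choose J) = 0"
    using assms(1) by eventually_elim (simp add: left_diff_distrib sum_subtractf)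
  ultimately have "(\<lambda>n. 0 :: real) \<longlonglongrightarrow> real_of_int (c J - c' J)"
    by (rule Lim_transform_eventually)
  then show False using J(2) by (simp add: LIMSEQ_const_iff)
qed

text \<open>Compares ranks by growth: \<open>p\<close> and \<open>q\<close> will be numbers of
  independent elements, and \<open>K\<close> absorbs the degree shifts caused by clearing
  denominators and changing generators.\<close>

lemma mult_choose_shift_leD:
  assumes "\<And>n. p * ((n + d) choose d) \<le> q * ((n + K + d) choose d)"
  shows "p \<le> q"
proof -
  have "(\<lambda>n. real q * (real ((n + K + d) choose d) / real ((n + d) choose d))) \<longlonglongrightarrow> real q * 1"
    by (intro tendsto_mult tendsto_const choose_ratio_tendsto_1)
  moreover have "real p \<le> real q * (real ((n + K + d) choose d) / real ((n + d) choose d))" for n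
  proof -
    have "0 < real ((n + d) choose d)" by simp
    moreover have "real p * real ((n + d) choose d) \<le> real q * real ((n + K + d) choose d)"
      using assms[of n] by (metis of_nat_le_iff of_nat_mult)
    ultimately show ?thesis by (simp add: field_simps)
  qed
  ultimately have "real p \<le> real q * 1"
    by (intro LIMSEQ_le_const) auto
  then show ?thesis by simp
qed

lemma binomial_sum_leading_coeff:
  fixes c :: "nat \<Rightarrow> int" and f :: "nat \<Rightarrow> nat"
  assumes f: "\<forall>\<^sub>F n in sequentially. int (f n) = (\<Sum>j\<le>d. c j * int ((n + j) choose j))"
    and lower: "\<And>n. r * ((n + d) choose d) \<le> f n"
    and upper: "\<And>n. f n \<le> r * ((n + K + d) choose d)"
  shows "c d = int r"
proof -
  have "(\<lambda>n. real_of_int (\<Sum>j\<le>d. c j * int ((n + j) choose j)) / real ((n + d) choose d))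
      \<longlonglongrightarrow> real_of_int (c d)"
    by (rule binomial_sum_ratio_tendsto) auto
  moreover have "\<forall>\<^sub>F n in sequentially.
      real_of_int (\<Sum>j\<le>d. c j * int ((n + j) choose j)) / real ((n + d) choose d) =
      real (f n) / real ((n + d) choose d)"
    using f by eventually_elim (metis of_int_of_nat_eq)
  ultimately have lim: "(\<lambda>n. real (f n) / real ((n + d) choose d)) \<longlonglongrightarrow> real_of_int (c d)"
    by (rule Lim_transform_eventually)
  have "(\<lambda>n. real r * (real ((n + K + d) choose d) / real ((n + d) choose d))) \<longlonglongrightarrow> real r * 1"
    by (intro tendsto_mult tendsto_const choose_ratio_tendsto_1)
  moreover have "real (f n) / real ((n + d) choose d) \<le>
      real r * (real ((n + K + d) choose d) / real ((n + d) choose d))" for n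
  proof -
    have "real (f n) \<le> real r * real ((n + K + d) choose d)"
      using upper[of n] by (metis of_nat_le_iff of_nat_mult)
    then show ?thesis by (simp add: divide_right_mono)
  qed
  ultimately have "real_of_int (c d) \<le> real r"
    using LIMSEQ_le[OF lim] by auto
  moreover have "real r \<le> real (f n) / real ((n + d) choose d)" for n
  proof -
    have "real r * real ((n + d) choose d) \<le> real (f n)"
      using lower[of n] by (metis of_nat_le_iff of_nat_mult)
    then show ?thesis by (simp add: pos_le_divide_eq)
  qed
  then have "real r \<le> real_of_int (c d)"
    by (intro LIMSEQ_le_const[OF lim]) auto
  ultimately show ?thesis by linarith
qed

text \<open>The leading coefficient has to be known exactly: only then does the top term cancel and
  leave a lower-order combination that dominates \<open>(n + d) choose d\<close>.\<close>

lemma binomial_sum_second_coeff_pos: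
  fixes c :: "nat \<Rightarrow> int" and f :: "nat \<Rightarrow> nat"
  assumes f: "\<forall>\<^sub>F n in sequentially. int (f n) = (\<Sum>j\<le>Suc d. c j * int ((n + j) choose j))"
    and lead: "c (Suc d) = int r"
    and lower: "\<And>n. r * ((n + Suc d) choose Suc d) + ((n + d) choose d) \<le> f n"
  shows "c d \<ge> 1"
proof -
  have lim: "(\<lambda>n. real_of_int (\<Sum>j\<le>d. c j * int ((n + j) choose j)) / real ((n + d) choose d))
      \<longlonglongrightarrow> real_of_int (c d)"
    by (rule binomial_sum_ratio_tendsto) auto
  have "\<forall>\<^sub>F n in sequentially.
      1 \<le> real_of_int (\<Sum>j\<le>d. c j * int ((n + j) choose j)) / real ((n + d) choose d)"
    using f
  proof eventually_elim
    case (elim n)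
    have "int (r * ((n + Suc d) choose Suc d) + ((n + d) choose d)) \<le> int (f n)"
      using lower[of n] by (simp only: of_nat_le_iff)
    then have "int ((n + d) choose d) \<le> (\<Sum>j\<le>d. c j * int ((n + j) choose j))"
      using lead by (simp add: elim del: binomial_Suc_Suc add_Suc_right)
    then have "real ((n + d) choose d) \<le> real_of_int (\<Sum>j\<le>d. c j * int ((n + j) choose j))"
      by (metis of_int_le_iff of_int_of_nat_eq)
    then show ?case by (simp add: pos_le_divide_eq)
  qed
  then have "1 \<le> real_of_int (c d)"
    by (intro tendsto_lowerbound[OF lim]) auto
  then show ?thesis by simp
qed

section \<open>Counting monomials in down-closed sets\<close>

lemma total_degree_0 [simp]: "total_degree 0 = 0"
  by (simp add: total_degree_def)

lemma total_degree_add [simp]: "total_degree (l + m) = total_degree l + total_degree m"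
  by (simp add: total_degree_def lookup_add sum.distrib)

lemma total_degree_single [simp]: "total_degree (Poly_Mapping.single v k) = k"
  by (simp add: total_degree_def lookup_single when_def)

lemma lookup_le_total_degree: "Poly_Mapping.lookup m v \<le> total_degree m"
  unfolding total_degree_def by (rule member_le_sum) auto

lemma finite_total_degree_le: "finite {m :: 'n::finite \<Rightarrow>\<^sub>0 nat. total_degree m \<le> n}"
proof (rule finite_imageD)
  show "finite (Poly_Mapping.lookup ` {m :: 'n \<Rightarrow>\<^sub>0 nat. total_degree m \<le> n})"
  proof (rule finite_subset)
    show "Poly_Mapping.lookup ` {m :: 'n \<Rightarrow>\<^sub>0 nat. total_degree m \<le> n} \<subseteq> PiE UNIV (\<lambda>_. {..n})"
      using lookup_le_total_degree le_trans by (fastforce simp: PiE_def)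
  qed (intro finite_PiE; simp)
  show "inj_on Poly_Mapping.lookup {m :: 'n \<Rightarrow>\<^sub>0 nat. total_degree m \<le> n}"
    by (auto intro!: inj_onI poly_mapping_eqI)
qed

text \<open>The set \<open>A\<close> of admissible variables is a parameter so that counting can
  proceed by induction on it within a fixed type of exponent vectors.\<close>

definition monomials_upto :: "'n::finite set \<Rightarrow> ('n \<Rightarrow>\<^sub>0 nat) set \<Rightarrow> nat \<Rightarrow> ('n \<Rightarrow>\<^sub>0 nat) set" where
  "monomials_upto A D n = {m \<in> D. Poly_Mapping.keys m \<subseteq> A \<and> total_degree m \<le> n}"

lemma finite_monomials_upto [simp]: "finite (monomials_upto A D n)"
  by (rule finite_subset[OF _ finite_total_degree_le]) (auto simp: monomials_upto_def)

lemma monomials_upto_empty: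
  "monomials_upto {} D n = (if 0 \<in> D then {0} else {})"
  by (auto simp: monomials_upto_def)

lemma card_monomials_upto_insert:
  assumes "v \<notin> A"
  shows "card (monomials_upto (insert v A) D n) =
    (\<Sum>k\<le>n. card (monomials_upto A {m. m + Poly_Mapping.single v k \<in> D} (n - k)))"
proof -
  define S where "S k = monomials_upto A {m. m + Poly_Mapping.single v k \<in> D} (n - k)" for k
  define h :: "nat \<times> ('a \<Rightarrow>\<^sub>0 nat) \<Rightarrow> 'a \<Rightarrow>\<^sub>0 nat" where "h = (\<lambda>(k, m). m + Poly_Mapping.single v k)"
  have no_v: "Poly_Mapping.lookup m v = 0" if "Poly_Mapping.keys m \<subseteq> A" for m :: "'a \<Rightarrow>\<^sub>0 nat"
    using that assms by (auto simp: in_keys_iff)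
  have "bij_betw h (Sigma {..n} S) (monomials_upto (insert v A) D n)"
  proof (rule bij_betw_imageI)
    show "inj_on h (Sigma {..n} S)"
    proof (rule inj_onI, clarify)
      fix k m k' m'
      assume *: "m \<in> S k" "m' \<in> S k'" "h (k, m) = h (k', m')"
      then have no_v': "Poly_Mapping.lookup m v = 0" "Poly_Mapping.lookup m' v = 0"
        by (auto simp: S_def monomials_upto_def no_v)
      have "Poly_Mapping.lookup (m + Poly_Mapping.single v k) v =
          Poly_Mapping.lookup (m' + Poly_Mapping.single v k') v"
        using *(3) by (simp add: h_def)
      then have "k = k'" by (simp add: lookup_add no_v')
      with * show "k = k' \<and> m = m'" by (simp add: h_def)
    qed
    show "h ` Sigma {..n} S = monomials_upto (insert v A) D n"
    proof (intro equalityI subsetI)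
      fix x assume "x \<in> h ` Sigma {..n} S"
      then obtain k m where km: "k \<le> n" "m \<in> S k" "x = m + Poly_Mapping.single v k"
        by (auto simp: h_def)
      then show "x \<in> monomials_upto (insert v A) D n"
        using keys_add[of m "Poly_Mapping.single v k"]
        by (auto simp: S_def monomials_upto_def split: if_splits)
    next
      fix x assume x: "x \<in> monomials_upto (insert v A) D n"
      define k where "k = Poly_Mapping.lookup x v"
      define m where "m = x - Poly_Mapping.single v k"
      have xm: "x = m + Poly_Mapping.single v k"
        by (rule poly_mapping_eqI) (simp add: m_def k_def lookup_add lookup_minus lookup_single when_def)
      have m_v: "Poly_Mapping.lookup m v = 0"
        by (simp add: m_def k_def lookup_minus)
      have "Poly_Mapping.keys m \<subseteq> A"
      proof
        fix t assume t: "t \<in> Poly_Mapping.keys m"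
        then have "t \<in> Poly_Mapping.keys x" "t \<noteq> v"
          using m_v by (auto simp: xm in_keys_iff lookup_add)
        then show "t \<in> A" using x by (auto simp: monomials_upto_def)
      qed
      then have "(k, m) \<in> Sigma {..n} S"
        using x xm total_degree_add[of m "Poly_Mapping.single v k"]
        by (auto simp: S_def monomials_upto_def)
      then show "x \<in> h ` Sigma {..n} S"
        by (force simp: h_def xm)
    qed
  qed
  then have "card (monomials_upto (insert v A) D n) = card (Sigma {..n} S)"
    by (simp add: bij_betw_same_card)
  also have "\<dots> = (\<Sum>k\<le>n. card (S k))"
    by (rule card_SigmaI) (auto simp: S_def)
  finally show ?thesis by (simp add: S_def)
qed

lemma card_monomials_upto:
  "card (monomials_upto A UNIV n) = (n + card A) choose card A"
  using finite[of A]
proof (induction A arbitrary: n rule: finite_induct)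
  case empty
  then show ?case by (simp add: monomials_upto_empty)
next
  case (insert v A)
  have "card (monomials_upto (insert v A) UNIV n) = (\<Sum>k\<le>n. (n - k + card A) choose card A)"
    using insert by (simp add: card_monomials_upto_insert)
  also have "\<dots> = (\<Sum>k\<le>n. (k + card A) choose card A)"
    by (rule sum.nat_diff_reindex[of _ "Suc n", simplified lessThan_Suc_atMost, simplified])
  finally show ?case
    using insert.hyps by (simp add: sum_choose_add_atMost del: binomial_Suc_Suc)
qed

lemma card_total_degree_le:
  "card {m :: 'n::finite \<Rightarrow>\<^sub>0 nat. total_degree m \<le> n} = (n + CARD('n)) choose CARD('n)"
  using card_monomials_upto[of UNIV n] by (simp add: monomials_upto_def)

section \<open>Dickson's lemma and counting in down-closed sets\<close>

lemma nat_seq_mono_subseq: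
  fixes f :: "nat \<Rightarrow> nat"
  obtains g :: "nat \<Rightarrow> nat" where "strict_mono g" and "mono (\<lambda>n. f (g n))"
proof -
  obtain g :: "nat \<Rightarrow> nat" where g: "strict_mono g" "monoseq (\<lambda>n. f (g n))"
    using seq_monosub[of f] by auto
  show thesis
  proof (cases "mono (\<lambda>n. f (g n))")
    case True
    with g show thesis using that by blast
  next
    case False
    with g(2) have dec: "f (g n) \<le> f (g m)" if "m \<le> n" for m n
      using that by (auto simp: monoseq_def mono_def)
    \<comment> \<open>The subsequence is nonincreasing here, so it stays at its least value once it
      has attained it; the constant tail is monotone.\<close>
    define a where "a = (LEAST a. \<exists>n. f (g n) = a)"
    have "\<exists>n. f (g n) = a"
      unfolding a_def by (rule LeastI) auto
    then obtain N where N: "f (g N) = a" ..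
    have const: "f (g (N + n)) = a" for n
    proof (rule antisym)
      show "f (g (N + n)) \<le> a" using dec[of N "N + n"] N by simp
      show "a \<le> f (g (N + n))" unfolding a_def by (rule Least_le) auto
    qed
    show thesis
    proof (rule that)
      show "strict_mono (\<lambda>n. g (N + n))"
        using g(1) by (auto simp: strict_mono_def)
      show "mono (\<lambda>n. f (g (N + n)))"
        by (simp add: const mono_def)
    qed
  qed
qed

text \<open>Monotone subsequences are chosen for one variable after another, and each refinement
  keeps the monotonicity already reached. In the end all exponents are monotone along
  \<open>g\<close>, so the first chosen monomial divides the second.\<close>

lemma dickson:
  fixes f :: "nat \<Rightarrow> 'n::finite \<Rightarrow>\<^sub>0 nat"
  obtains i j l where "i < j" and "f j = f i + l"
proof -
  have "\<exists>g :: nat \<Rightarrow> nat. strict_mono g \<and> (\<forall>v\<in>A. mono (\<lambda>n. Poly_Mapping.lookup (f (g n)) v))"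
    for A :: "'n set"
    using finite[of A]
  proof (induction A rule: finite_induct)
    case empty
    show ?case by (intro exI[of _ "\<lambda>n. n"]) (simp add: strict_mono_def)
  next
    case (insert v A)
    then obtain g :: "nat \<Rightarrow> nat" where g: "strict_mono g"
        "\<And>v. v \<in> A \<Longrightarrow> mono (\<lambda>n. Poly_Mapping.lookup (f (g n)) v)"
      by blast
    obtain h :: "nat \<Rightarrow> nat" where h: "strict_mono h"
        "mono (\<lambda>n. Poly_Mapping.lookup (f (g (h n))) v)"
      by (rule nat_seq_mono_subseq[of "\<lambda>n. Poly_Mapping.lookup (f (g n)) v"])
    have "mono (\<lambda>n. Poly_Mapping.lookup (f (g (h n))) w)" if "w \<in> A" for w
      using g(2)[OF that] strict_mono_mono[OF h(1)] by (simp add: mono_def)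
    moreover have "strict_mono (\<lambda>n. g (h n))"
      using g(1) h(1) by (simp add: strict_mono_def)
    ultimately show ?case using h(2) by (intro exI[of _ "\<lambda>n. g (h n)"]) auto
  qed
  then obtain g :: "nat \<Rightarrow> nat" where g: "strict_mono g"
      "\<And>v. mono (\<lambda>n. Poly_Mapping.lookup (f (g n)) v)"
    by (metis UNIV_I)
  show thesis
  proof (rule that[of "g 0" "g 1"])
    show "g 0 < g 1" using g(1) by (simp add: strict_mono_def)
    show "f (g 1) = f (g 0) + (f (g 1) - f (g 0))"
    proof (rule poly_mapping_eqI)
      fix v
      have "Poly_Mapping.lookup (f (g 0)) v \<le> Poly_Mapping.lookup (f (g 1)) v"
        using g(2)[of v] by (auto dest: monoD[of _ 0 1])
      then show "Poly_Mapping.lookup (f (g 1)) v = Poly_Mapping.lookup (f (g 0) + (f (g 1) - f (g 0))) v"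
        by (simp add: lookup_add lookup_minus)
    qed
  qed
qed

definition down_closed :: "('n \<Rightarrow>\<^sub>0 nat) set \<Rightarrow> bool" where
  "down_closed D \<longleftrightarrow> (\<forall>l m. l + m \<in> D \<longrightarrow> m \<in> D)"

text \<open>In a chain that never settles, pick a monomial lost at each strict descent. Dickson's
  lemma makes an earlier pick divide a later one, and down-closedness puts the earlier pick back
  into a set that it has left.\<close>

lemma decseq_down_closed_stabilizes:
  fixes D :: "nat \<Rightarrow> ('n::finite \<Rightarrow>\<^sub>0 nat) set"
  assumes dc: "\<And>k. down_closed (D k)" and dec: "\<And>k. D (Suc k) \<subseteq> D k"
  obtains K where "\<And>k. k \<ge> K \<Longrightarrow> D k = D K"
proof -
  have anti: "D k \<subseteq> D j" if "j \<le> k" for j k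
    using that dec by (induction rule: dec_induct) auto
  have "\<exists>K. \<forall>k\<ge>K. D k = D K"
  proof (rule ccontr)
    assume "\<nexists>K. \<forall>k\<ge>K. D k = D K"
    then have "\<forall>K. \<exists>k. k \<ge> K \<and> D k \<subset> D K"
      using anti by blast
    then obtain s where s: "\<And>K. s K \<ge> K" "\<And>K. D (s K) \<subset> D K" by metis
    define q where "q i = (s ^^ i) 0" for i
    have q: "D (q (Suc i)) \<subset> D (q i)" "q i \<le> q (Suc i)" for i
      using s by (auto simp: q_def)
    have qmono: "q i \<le> q j" if "i \<le> j" for i j
      using that q(2) by (rule lift_Suc_mono_le[rotated])
    have "\<forall>i. \<exists>m. m \<in> D (q i) \<and> m \<notin> D (q (Suc i))" using q(1) by blast
    then obtain f where f: "\<And>i. f i \<in> D (q i)" "\<And>i. f i \<notin> D (q (Suc i))" by metis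
    obtain i j l where ij: "i < j" "f j = f i + l" by (rule dickson)
    have "f j \<in> D (q (Suc i))"
      using f(1)[of j] anti[OF qmono[of "Suc i" j]] ij(1) by auto
    then have "f i \<in> D (q (Suc i))"
      using dc ij(2) unfolding down_closed_def by (metis add.commute)
    with f(2) show False by blast
  qed
  then show thesis using that by blast
qed

text \<open>
  Slicing along a variable expresses the count through the counts of the slices, which form a
  decreasing, hence eventually constant, sequence.
\<close>

lemma binomial_type_down_closed:
  fixes D :: "('n::finite \<Rightarrow>\<^sub>0 nat) set"
  assumes "down_closed D"
  shows "binomial_type (card A) (\<lambda>n. int (card (monomials_upto A D n)))"
  using finite[of A] assms
proof (induction A arbitrary: D rule: finite_induct)
  case empty
  then show ?case by (simp add: monomials_upto_empty binomial_type_const binomial_type_0)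
next
  case (insert v A)
  define S where "S k = {m. m + Poly_Mapping.single v k \<in> D}" for k
  define f where "f k n = int (card (monomials_upto A (S k) n))" for k n
  have dc: "down_closed (S k)" for k
    using insert.prems by (simp add: down_closed_def S_def add.assoc)
  have dec: "S (Suc k) \<subseteq> S k" for k
  proof
    fix m assume "m \<in> S (Suc k)"
    moreover have "m + Poly_Mapping.single v (Suc k) =
        Poly_Mapping.single v 1 + (m + Poly_Mapping.single v k)"
      using single_add[of v 1 k] by (simp add: ac_simps)
    ultimately have "Poly_Mapping.single v 1 + (m + Poly_Mapping.single v k) \<in> D"
      by (simp add: S_def)
    then show "m \<in> S k" using insert.prems by (auto simp: S_def down_closed_def)
  qed
  obtain K where K: "\<And>k. k \<ge> K \<Longrightarrow> S k = S K"
    using decseq_down_closed_stabilizes[of S] dc dec by blast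
  have f: "binomial_type (card A) (f k)" for k
    unfolding f_def by (rule insert.IH[OF dc])
  have "(\<Sum>k<K. f k (n - k)) + (\<Sum>k\<le>n - K. f K k) =
      int (card (monomials_upto (insert v A) D n))" if "n \<ge> K" for n
  proof -
    have "int (card (monomials_upto (insert v A) D n)) = (\<Sum>k\<le>n. f k (n - k))"
      using insert.hyps by (simp add: card_monomials_upto_insert f_def S_def)
    also have "\<dots> = (\<Sum>k<K. f k (n - k)) + (\<Sum>k=K..n. f k (n - k))"
      using that by (subst sum.union_disjoint[symmetric]) (auto intro!: sum.cong)
    also have "(\<Sum>k=K..n. f k (n - k)) = (\<Sum>k=K..n. f K (n - k))"
    proof (rule sum.cong)
      fix k assume "k \<in> {K..n}"
      then have "S k = S K" by (intro K) simp
      then show "f k (n - k) = f K (n - k)" by (simp add: f_def)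
    qed simp
    also have "\<dots> = (\<Sum>k\<le>n - K. f K k)"
      using that by (intro sum.reindex_bij_witness[of _ "\<lambda>k. n - k" "\<lambda>k. n - k"]) auto
    finally show ?thesis by simp
  qed
  then have ev: "\<forall>\<^sub>F n in sequentially. (\<Sum>k<K. f k (n - k)) + (\<Sum>k\<le>n - K. f K k) =
      int (card (monomials_upto (insert v A) D n))"
    unfolding eventually_sequentially by blast
  \<comment> \<open>Only the sum over the stable slice raises the type by one; the first
    \<open>K\<close> slices enter as single shifted terms.\<close>
  have "binomial_type (Suc (card A)) (\<lambda>n. (\<Sum>k<K. f k (n - k)) + (\<Sum>k\<le>n - K. f K k))"
  proof (rule binomial_type_add)
    show "binomial_type (Suc (card A)) (\<lambda>n. \<Sum>k<K. f k (n - k))"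
      by (intro binomial_type_sum binomial_type_shift binomial_type_mono[OF f]) simp
    show "binomial_type (Suc (card A)) (\<lambda>n. \<Sum>k\<le>n - K. f K k)"
      by (rule binomial_type_shift[OF binomial_type_cumulative[OF f]])
  qed
  with ev have "binomial_type (Suc (card A)) (\<lambda>n. int (card (monomials_upto (insert v A) D n)))"
    by (rule binomial_type_cong)
  then show ?case using insert.hyps by simp
qed

section \<open>Dimensions and weighted parts of polynomials\<close>

context vector_space
begin

lemma card_le_dim_span:
  assumes "independent S" and "S \<subseteq> span T" and "finite T"
  shows "card S \<le> dim T"
proof -
  obtain C where C: "C \<subseteq> T" "independent C" "T \<subseteq> span C" "card C = dim T"
    by (rule basis_exists)
  have "S \<subseteq> span C"
    using assms(2) C(3) span_minimal[OF C(3)] by auto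
  then show ?thesis
    using independent_span_bound[of C S] assms(1,3) C(1,4) finite_subset by metis
qed

text \<open>An image silently merges equal vectors, hence the injectivity claim; a repetition would
  give a relation with coefficients \<open>1\<close> and \<open>- 1\<close>.\<close>

lemma independent_familyI:
  assumes "finite I"
    and indep: "\<And>c i. (\<Sum>i\<in>I. c i *s v i) = 0 \<Longrightarrow> i \<in> I \<Longrightarrow> c i = 0"
  shows "inj_on v I" and "independent (v ` I)"
proof -
  show inj: "inj_on v I"
  proof (rule inj_onI, rule ccontr)
    fix i j assume ij: "i \<in> I" "j \<in> I" "v i = v j" "i \<noteq> j"
    define c :: "_ \<Rightarrow> 'a" where "c k = (if k = i then 1 else if k = j then - 1 else 0)" for k
    have "(\<Sum>k\<in>I. c k *s v k) = (\<Sum>k\<in>{i, j}. c k *s v k)"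
      using assms(1) ij by (intro sum.mono_neutral_right) (auto simp: c_def)
    also have "\<dots> = 0" using ij by (simp add: c_def)
    finally have "c i = 0" using indep ij by blast
    then show False by (simp add: c_def)
  qed
  show "independent (v ` I)"
  proof (rule independent_if_scalars_zero)
    show "finite (v ` I)" using assms(1) by simp
    fix f x assume "(\<Sum>x\<in>v ` I. f x *s x) = 0" "x \<in> v ` I"
    then show "f x = 0"
      using indep[of "\<lambda>i. f (v i)"] inj by (auto simp: sum.reindex)
  qed
qed

lemma card_family_le_dim:
  assumes "finite I"
    and "\<And>c i. (\<Sum>i\<in>I. c i *s v i) = 0 \<Longrightarrow> i \<in> I \<Longrightarrow> c i = 0"
    and "v ` I \<subseteq> span T" and "finite T"
  shows "card I \<le> dim T"
proof -
  have "inj_on v I" "independent (v ` I)"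
    by (rule independent_familyI; use assms(1,2) in blast)+
  then show ?thesis
    using card_le_dim_span[OF _ assms(3,4)] by (simp add: card_image)
qed

lemma dim_Un_direct:
  assumes "finite S" and "finite T" and "span S \<inter> span T = {0}"
  shows "dim (S \<union> T) = dim S + dim T"
proof -
  obtain C where C: "C \<subseteq> S" "independent C" "S \<subseteq> span C" "card C = dim S"
    by (rule basis_exists)
  obtain E where E: "E \<subseteq> T" "independent E" "T \<subseteq> span E" "card E = dim T"
    by (rule basis_exists)
  have fin: "finite C" "finite E" using C E assms finite_subset by blast+
  have sub: "span C \<inter> span E = {0}"
    using span_mono[OF C(1)] span_mono[OF E(1)] assms(3) span_zero by blast
  have "independent (C \<union> E') \<and> C \<inter> E' = {}" if "E' \<subseteq> E" for E'
  proof -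
    have "finite E'" using that fin finite_subset by blast
    then show ?thesis using that
    proof (induction E' rule: finite_induct)
      case empty
      then show ?case using C by simp
    next
      case (insert x F)
      have xE: "x \<notin> span F"
      proof -
        have "x \<notin> span (E - {x})" using E(2) insert.prems by (auto simp: dependent_def)
        moreover have "F \<subseteq> E - {x}" using insert by auto
        ultimately show ?thesis using span_mono by blast
      qed
      have "x \<notin> span (C \<union> F)"
      proof
        assume "x \<in> span (C \<union> F)"
        then obtain a b where ab: "x = a + b" "a \<in> span C" "b \<in> span F"
          by (auto simp: span_Un)
        have "a = x - b" using ab by simp
        also have "\<dots> \<in> span E"
          using ab(3) span_mono[of F E] insert.prems by (intro span_diff) (auto intro: span_base)
        finally have "a = 0" using ab(2) sub by auto
        with ab xE show False by simp
      qed
      moreover have "independent (C \<union> F)" using insert by simp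
      ultimately have "independent (insert x (C \<union> F))" by (rule independent_insertI)
      moreover have "x \<notin> C"
        using \<open>x \<notin> span (C \<union> F)\<close> span_base[of x "C \<union> F"] by auto
      ultimately have "independent (insert x (C \<union> F))" "x \<notin> C" by simp_all
      then show ?case using insert by simp
    qed
  qed
  from this[of E] have ind: "independent (C \<union> E)" "C \<inter> E = {}" by auto
  have "S \<union> T \<subseteq> span (C \<union> E)"
    using C(3) E(3) span_mono[of C "C \<union> E"] span_mono[of E "C \<union> E"] by auto
  then have "dim (S \<union> T) = card (C \<union> E)"
    using C(1) E(1) ind(1) by (intro dim_unique) (auto intro: span_superset[THEN subsetD])
  then show ?thesis using fin ind(2) C E by (simp add: card_Un_disjoint)
qed

text \<open>The vectors outside the span of their predecessors form a basis. The induction adds an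
  element of largest key, which changes no earlier test; injectivity of \<open>key\<close> makes
  comparisons with it strict. Applied to \<open>act\<close>, it counts standard monomials.\<close>

lemma dim_greedy:
  fixes key :: "'i \<Rightarrow> 'o::linorder"
  assumes "finite I" and "inj_on key I"
  shows "dim (v ` I) = card {i \<in> I. v i \<notin> span (v ` {j \<in> I. key j < key i})}"
proof -
  define S where "S I = {i \<in> I. v i \<notin> span (v ` {j \<in> I. key j < key i})}" for I
  have "inj_on v (S I) \<and> independent (v ` S I) \<and> v ` I \<subseteq> span (v ` S I)"
    using assms
  proof (induction I rule: finite_ranking_induct[where f = key])
    case empty
    then show ?case by (simp add: S_def independent_empty)
  next
    case (insert x I)
    show ?case
    proof (cases "x \<in> I")
      case True
      then show ?thesis using insert by (simp add: insert_absorb)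
    next
      case False
      have lt: "key y < key x" if "y \<in> I" for y
        using insert.hyps(2)[OF that] insert.prems that False
        by (auto simp: inj_on_def order.order_iff_strict)
      have IH: "inj_on v (S I)" "independent (v ` S I)" "v ` I \<subseteq> span (v ` S I)"
        using insert by auto
      have "{j \<in> insert x I. key j < key i} = {j \<in> I. key j < key i}" if "i \<in> insert x I" for i
        using that lt by (auto dest: order.asym)
      then have "S (insert x I) = {i \<in> insert x I. v i \<notin> span (v ` {j \<in> I. key j < key i})}"
        unfolding S_def by (metis (no_types, lifting))
      moreover have "{j \<in> I. key j < key x} = I" using lt by auto
      ultimately have SI: "S (insert x I) = (if v x \<in> span (v ` I) then S I else insert x (S I))"
        by (auto simp: S_def)
      have eq: "span (v ` I) = span (v ` S I)"
        by (rule span_eq[THEN iffD2]) (use IH(3) in \<open>auto simp: S_def intro!: span_base\<close>)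
      show ?thesis
      proof (cases "v x \<in> span (v ` I)")
        case True
        then show ?thesis using SI IH eq by simp
      next
        case nin: False
        have "v ` insert x I \<subseteq> span (v ` S (insert x I))"
          using IH(3) SI nin span_mono[of "v ` S I" "v ` S (insert x I)"]
          by (auto intro: span_base)
        moreover have "v x \<notin> v ` S I" using nin eq span_base by metis
        moreover have "independent (insert (v x) (v ` S I))"
          by (rule independent_insertI) (use nin IH eq in simp_all)
        ultimately show ?thesis
          using SI nin IH(1) eq by auto
      qed
    qed
  qed
  then have inj: "inj_on v (S I)" and "independent (v ` S I)" "v ` I \<subseteq> span (v ` S I)"
    by auto
  then have "card (v ` S I) = dim (v ` I)"
    by (intro basis_card_eq_dim) (auto simp: S_def)
  moreover have "card (v ` S I) = card (S I)" by (rule card_image[OF inj])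
  ultimately have "dim (v ` I) = card (S I)" by simp
  then show ?thesis by (simp add: S_def)
qed

end

section \<open>Parts of a polynomial by weight\<close>

definition weight_part :: "('a \<Rightarrow> nat) \<Rightarrow> nat \<Rightarrow> ('a \<Rightarrow>\<^sub>0 'b::zero) \<Rightarrow> ('a \<Rightarrow>\<^sub>0 'b)" where
  "weight_part w j p = Poly_Mapping.mapp (\<lambda>m c. c when w m = j) p"

lemma lookup_weight_part:
  "Poly_Mapping.lookup (weight_part w j p) m = (Poly_Mapping.lookup p m when w m = j)"
  by (simp add: weight_part_def lookup_mapp when_def in_keys_iff)

lemma keys_weight_part:
  "Poly_Mapping.keys (weight_part w j p) = {m \<in> Poly_Mapping.keys p. w m = j}"
  by (auto simp: in_keys_iff lookup_weight_part)

lemma weight_part_add: "weight_part w j (p + q) = weight_part w j p + weight_part w j q"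
  by (rule poly_mapping_eqI) (simp add: lookup_weight_part lookup_add when_add_distrib)

lemma weight_part_id:
  "(\<And>m. m \<in> Poly_Mapping.keys p \<Longrightarrow> w m = j) \<Longrightarrow> weight_part w j p = p"
  by (rule poly_mapping_eqI) (auto simp: lookup_weight_part when_def in_keys_iff)

lemma weight_part_eq_0:
  "(\<And>m. m \<in> Poly_Mapping.keys p \<Longrightarrow> w m \<noteq> j) \<Longrightarrow> weight_part w j p = 0"
  by (rule poly_mapping_eqI) (auto simp: lookup_weight_part when_def in_keys_iff)

lemma keys_diff_weight_part:
  fixes p :: "'a \<Rightarrow>\<^sub>0 'b::ab_group_add"
  shows "Poly_Mapping.keys (p - weight_part w j p) = {m \<in> Poly_Mapping.keys p. w m \<noteq> j}"
  by (auto simp: in_keys_iff lookup_weight_part lookup_minus when_def)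

lemma sum_single_keys:
  fixes p :: "'a \<Rightarrow>\<^sub>0 'b::comm_monoid_add"
  shows "(\<Sum>m\<in>Poly_Mapping.keys p. Poly_Mapping.single m (Poly_Mapping.lookup p m)) = p"
  by (rule poly_mapping_eqI) (auto simp: lookup_sum lookup_single when_def in_keys_iff)

text \<open>Later \<open>w\<close> is the exponent of a single variable, so a weight part consists
  of the terms with a given power of that variable.\<close>

locale monomial_weight =
  fixes w :: "'a::comm_monoid_add \<Rightarrow> nat"
  assumes weight_add: "w (l + m) = w l + w m"
begin

lemma weight_keys_mult:
  fixes p q :: "'a \<Rightarrow>\<^sub>0 'b::comm_ring_1"
  assumes "m \<in> Poly_Mapping.keys (p * q)"
  obtains a b where "a \<in> Poly_Mapping.keys p" "b \<in> Poly_Mapping.keys q" "w m = w a + w b"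
  using assms keys_mult[of p q] weight_add by blast

lemma weight_part_mult_homogeneous:
  fixes s u :: "'a \<Rightarrow>\<^sub>0 'b::comm_ring_1"
  assumes "\<And>m. m \<in> Poly_Mapping.keys s \<Longrightarrow> w m = a"
  shows "weight_part w (a + j) (s * u) = s * weight_part w j u"
proof -
  define u' where "u' = u - weight_part w j u"
  have "s * u = s * weight_part w j u + s * u'"
    by (simp add: u'_def algebra_simps)
  moreover have "weight_part w (a + j) (s * weight_part w j u) = s * weight_part w j u"
  proof (rule weight_part_id)
    fix m assume "m \<in> Poly_Mapping.keys (s * weight_part w j u)"
    then show "w m = a + j"
      by (rule weight_keys_mult) (use assms in \<open>auto simp: keys_weight_part\<close>)
  qed
  moreover have "weight_part w (a + j) (s * u') = 0"
  proof (rule weight_part_eq_0)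
    fix m assume "m \<in> Poly_Mapping.keys (s * u')"
    then show "w m \<noteq> a + j"
      by (rule weight_keys_mult) (use assms in \<open>auto simp: u'_def keys_diff_weight_part\<close>)
  qed
  ultimately show ?thesis by (simp add: weight_part_add)
qed

text \<open>Weight \<open>e + f\<close> can only come from weight \<open>e\<close> in
  \<open>t\<close> and weight \<open>f\<close> in \<open>q\<close>, because both are upper
  bounds.\<close>

lemma weight_part_mult_top:
  fixes t q :: "'a \<Rightarrow>\<^sub>0 'b::comm_ring_1"
  assumes t: "\<And>m. m \<in> Poly_Mapping.keys t \<Longrightarrow> w m \<le> e"
    and q: "\<And>m. m \<in> Poly_Mapping.keys q \<Longrightarrow> w m \<le> f"
  shows "weight_part w (e + f) (t * q) = weight_part w e t * weight_part w f q"
proof -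
  define t' where "t' = t - weight_part w e t"
  have "t * q = weight_part w e t * q + t' * q"
    by (simp add: t'_def algebra_simps)
  moreover have "weight_part w (e + f) (t' * q) = 0"
  proof (rule weight_part_eq_0)
    fix m assume "m \<in> Poly_Mapping.keys (t' * q)"
    then obtain a b where "a \<in> Poly_Mapping.keys t'" "b \<in> Poly_Mapping.keys q" "w m = w a + w b"
      by (rule weight_keys_mult)
    then show "w m \<noteq> e + f"
      using t[of a] q[of b] by (auto simp: t'_def keys_diff_weight_part)
  qed
  moreover have "weight_part w (e + f) (weight_part w e t * q) = weight_part w e t * weight_part w f q"
    by (rule weight_part_mult_homogeneous) (simp add: keys_weight_part)
  ultimately show ?thesis by (simp add: weight_part_add)
qed

text \<open>
  Modulo \<open>s\<close>, a zero divisor equation \<open>t * q = 0\<close> persists for the leading part of \<open>t\<close>, after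
  raising it to the number of weights occurring in \<open>q\<close>.
\<close>

lemma top_part_power_mult:
  fixes s t q u :: "'a \<Rightarrow>\<^sub>0 'b::comm_ring_1"
  assumes s: "\<And>m. m \<in> Poly_Mapping.keys s \<Longrightarrow> w m = 0"
    and t: "\<And>m. m \<in> Poly_Mapping.keys t \<Longrightarrow> w m \<le> e"
    and eq: "t * q = s * u"
  shows "\<exists>N u'. weight_part w e t ^ N * q = s * u'"
  using eq
proof (induction "card (w ` Poly_Mapping.keys q)" arbitrary: q u rule: less_induct)
  case less
  define te where "te = weight_part w e t"
  show ?case
  proof (cases "q = 0")
    case True
    then show ?thesis by (intro exI[of _ 0]) simp
  next
    case False
    then have ne: "w ` Poly_Mapping.keys q \<noteq> {}" by auto
    define f where "f = Max (w ` Poly_Mapping.keys q)"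
    \<comment> \<open>Dropping the top weight of \<open>q\<close> and multiplying by
      \<open>te\<close> keeps an equation of the same shape and leaves fewer weights: the remaining
      ones are only shifted by \<open>e\<close>.\<close>
    define q' where "q' = te * (q - weight_part w f q)"
    \<comment> \<open>Compare the parts of weight \<open>e + f\<close> in
      \<open>t * q = s * u\<close>; as \<open>s\<close> has weight 0, it factors out on the
      right.\<close>
    have "te * weight_part w f q = weight_part w (0 + (e + f)) (s * u)"
      unfolding te_def less.prems[symmetric]
      using weight_part_mult_top[of t e q f] t by (simp add: f_def)
    also have "\<dots> = s * weight_part w (e + f) u"
      using s by (rule weight_part_mult_homogeneous)
    finally have top: "te * weight_part w f q = s * weight_part w (e + f) u" .
    have "t * q' = te * (t * q) - t * (te * weight_part w f q)"
      by (simp add: q'_def algebra_simps)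
    also have "\<dots> = te * (s * u) - t * (s * weight_part w (e + f) u)"
      by (simp only: less.prems top)
    finally have eq': "t * q' = s * (te * u - t * weight_part w (e + f) u)"
      by (simp add: algebra_simps)
    have "w ` Poly_Mapping.keys q' \<subseteq> (+) e ` (w ` Poly_Mapping.keys q - {f})"
    proof
      fix x assume "x \<in> w ` Poly_Mapping.keys q'"
      then obtain m where "m \<in> Poly_Mapping.keys q'" "x = w m" by auto
      then show "x \<in> (+) e ` (w ` Poly_Mapping.keys q - {f})"
        unfolding q'_def te_def
        by (elim weight_keys_mult) (auto simp: keys_weight_part keys_diff_weight_part)
    qed
    then have "card (w ` Poly_Mapping.keys q') \<le> card ((+) e ` (w ` Poly_Mapping.keys q - {f}))"
      by (intro card_mono) auto
    also have "\<dots> = card (w ` Poly_Mapping.keys q - {f})"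
      by (rule card_image) simp
    also have "\<dots> < card (w ` Poly_Mapping.keys q)"
      using ne by (intro card_Diff1_less) (auto simp: f_def)
    finally obtain N u' where N: "te ^ N * q' = s * u'"
      using less.hyps[OF _ eq'] by (auto simp: te_def)
    have "te ^ Suc N * q = te ^ N * q' + te ^ N * (te * weight_part w f q)"
      by (simp add: q'_def algebra_simps)
    also have "\<dots> = s * u' + te ^ N * (s * weight_part w (e + f) u)"
      by (simp only: N top)
    also have "\<dots> = s * (u' + te ^ N * weight_part w (e + f) u)"
      by (simp add: algebra_simps)
    finally show ?thesis unfolding te_def by blast
  qed
qed

end

lemma monomial_weight_lookup: "monomial_weight (\<lambda>m :: 'n \<Rightarrow>\<^sub>0 nat. Poly_Mapping.lookup m v)"
  by unfold_locales (simp add: lookup_add)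

abbreviation monomial :: "('n \<Rightarrow>\<^sub>0 nat) \<Rightarrow> ('n::finite, 'k::field) polynomial" where
  "monomial m \<equiv> Poly_Mapping.single m 1"

lemma single_variable_dvd:
  fixes p :: "('n::finite, 'k::field) polynomial"
  assumes "\<And>m. m \<in> Poly_Mapping.keys p \<Longrightarrow> Poly_Mapping.lookup m v \<noteq> 0"
  shows "\<exists>p'. p = monomial (Poly_Mapping.single v 1) * p'"
proof -
  \<comment> \<open>The truncated subtraction of exponents is exact, since \<open>v\<close> occurs
    in every monomial of \<open>p\<close>.\<close>
  define p' where
    "p' = (\<Sum>m\<in>Poly_Mapping.keys p.
        Poly_Mapping.single (m - Poly_Mapping.single v 1) (Poly_Mapping.lookup p m))"
  have "Poly_Mapping.single v 1 + (m - Poly_Mapping.single v 1) = m" if "m \<in> Poly_Mapping.keys p" for m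
  proof (rule poly_mapping_eqI)
    fix x
    show "Poly_Mapping.lookup (Poly_Mapping.single v 1 + (m - Poly_Mapping.single v 1)) x =
        Poly_Mapping.lookup m x"
      using assms[OF that] by (auto simp: lookup_add lookup_minus lookup_single when_def)
  qed
  then have "monomial (Poly_Mapping.single v 1) * p' = p"
    by (simp add: p'_def sum_distrib_left mult_single sum_single_keys)
  then show ?thesis by metis
qed

section \<open>Torsion-free modules over the polynomial ring\<close>

lemma (in monomial_weight) homogeneous_power:
  fixes p :: "'a \<Rightarrow>\<^sub>0 'b::comm_ring_1"
  assumes "\<And>m. m \<in> Poly_Mapping.keys p \<Longrightarrow> w m = a"
  shows "m \<in> Poly_Mapping.keys (p ^ N) \<Longrightarrow> w m = N * a"
proof (induction N arbitrary: m)
  case 0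
  moreover have "w 0 = 0" using weight_add[of 0 0] by simp
  ultimately show ?case by simp
next
  case (Suc N)
  have "m \<in> Poly_Mapping.keys (p * p ^ N)" using Suc.prems by simp
  then show ?case
    by (rule weight_keys_mult) (use Suc.IH assms in auto)
qed

locale torsion_free_module = module scale
  for scale :: "('n::finite, 'k::field) polynomial \<Rightarrow> 'm::ab_group_add \<Rightarrow> 'm"  (infixr \<open>*s\<close> 75) +
  assumes tf: torsion_free
    and nontrivial: "\<exists>x::'m. x \<noteq> 0"
begin

lemma scale_eq_0D: "r *s x = 0 \<Longrightarrow> r = 0 \<or> x = 0"
  using tf by (simp add: torsion_free_def)

lemma scale_cancel: "r \<noteq> 0 \<Longrightarrow> r *s x = r *s y \<Longrightarrow> x = y"
  using scale_eq_0D[of r "x - y"] by (simp add: scale_right_diff_distrib)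

text \<open>
  The library makes polynomials an integral domain only for linearly ordered exponents. Here the
  absence of zero divisors is inherited from the module.
\<close>

lemma poly_mult_eq_0D:
  fixes p q :: "('n, 'k) polynomial"
  assumes "p * q = 0"
  shows "p = 0 \<or> q = 0"
proof -
  obtain x :: 'm where "x \<noteq> 0" using nontrivial by blast
  moreover have "p *s q *s x = 0" using assms by simp
  ultimately show ?thesis using scale_eq_0D by blast
qed

lemma poly_power_neq_0: "(p :: ('n, 'k) polynomial) \<noteq> 0 \<Longrightarrow> p ^ N \<noteq> 0"
  by (induction N) (use poly_mult_eq_0D in auto)

lemma poly_prod_neq_0:
  fixes f :: "'i \<Rightarrow> ('n, 'k) polynomial"
  shows "finite I \<Longrightarrow> (\<And>i. i \<in> I \<Longrightarrow> f i \<noteq> 0) \<Longrightarrow> prod f I \<noteq> 0"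
  by (induction I rule: finite_induct) (use poly_mult_eq_0D in auto)

section \<open>Denominators of elements over a free submodule\<close>

context
  fixes B :: "'m set"
  assumes fin: "finite B" and indep: "independent B"
begin

lemma coordinates: "y \<in> span B \<Longrightarrow> \<exists>p. y = (\<Sum>b\<in>B. p b *s b)"
  by (auto simp: span_finite[OF fin])

lemma coordinates_unique:
  assumes "(\<Sum>b\<in>B. p b *s b) = (\<Sum>b\<in>B. q b *s b)" and "b \<in> B"
  shows "p b = q b"
proof -
  have "(\<Sum>b\<in>B. (p b - q b) *s b) = 0"
    using assms(1) by (simp add: scale_left_diff_distrib sum_subtractf)
  then show ?thesis
    using independentD[OF indep fin, of "\<lambda>b. p b - q b"] assms(2) by simp
qed

text \<open>Both products are the coordinate at \<open>b\<close> of \<open>t *s s *s y\<close>.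
  Membership of multiples of \<open>y\<close> in the span thus becomes divisibility among
  polynomials.\<close>

lemma cross_multiply:
  assumes "t *s y = (\<Sum>b\<in>B. p b *s b)" and "s *s y = (\<Sum>b\<in>B. q b *s b)" and "b \<in> B"
  shows "t * q b = s * p b"
proof (rule coordinates_unique[OF _ assms(3)])
  have "(\<Sum>b\<in>B. (t * q b) *s b) = t *s s *s y"
    by (simp add: assms(2) scale_sum_right)
  also have "\<dots> = s *s t *s y" by (simp add: mult.commute)
  also have "\<dots> = (\<Sum>b\<in>B. (s * p b) *s b)"
    by (simp only: assms(1) scale_sum_right scale_scale)
  finally show "(\<Sum>b\<in>B. (t * q b) *s b) = (\<Sum>b\<in>B. (s * p b) *s b)" .
qed

lemma mem_span_if_scale_eq:
  assumes "s \<noteq> 0" and "s *s y = (\<Sum>b\<in>B. (s * p b) *s b)"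
  shows "y \<in> span B"
proof -
  have "s *s y = s *s (\<Sum>b\<in>B. p b *s b)"
    using assms(2) by (simp add: scale_sum_right)
  then have "y = (\<Sum>b\<in>B. p b *s b)"
    by (rule scale_cancel[OF assms(1)])
  then show ?thesis
    by (auto intro!: span_sum span_scale intro: span_base)
qed

text \<open>By cross multiplication, \<open>t\<close> sends each coordinate \<open>q b\<close> of
  \<open>s *s y\<close> into the multiples of \<open>s\<close>, and a power of the leading part of
  \<open>t\<close> does the same. Once all coordinates are divisible by \<open>s\<close>,
  torsion-freeness cancels it.\<close>

lemma top_part_power_mem_span:
  assumes "t *s y \<in> span B" and "s *s y \<in> span B" and "s \<noteq> 0"
    and s: "\<And>m. m \<in> Poly_Mapping.keys s \<Longrightarrow> Poly_Mapping.lookup m v = 0"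
    and t: "\<And>m. m \<in> Poly_Mapping.keys t \<Longrightarrow> Poly_Mapping.lookup m v \<le> e"
  shows "\<exists>N. weight_part (\<lambda>m. Poly_Mapping.lookup m v) e t ^ N *s y \<in> span B"
proof -
  interpret monomial_weight "\<lambda>m :: 'n \<Rightarrow>\<^sub>0 nat. Poly_Mapping.lookup m v"
    by (rule monomial_weight_lookup)
  define te where "te = weight_part (\<lambda>m. Poly_Mapping.lookup m v) e t"
  obtain p where p: "t *s y = (\<Sum>b\<in>B. p b *s b)"
    using coordinates[OF assms(1)] ..
  obtain q where q: "s *s y = (\<Sum>b\<in>B. q b *s b)"
    using coordinates[OF assms(2)] ..
  have "\<exists>N u. te ^ N * q b = s * u" if "b \<in> B" for b
    using top_part_power_mult[of s t e "q b" "p b"] s t cross_multiply[OF p q that]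
    by (auto simp: te_def)
  then obtain N u where N: "\<And>b. b \<in> B \<Longrightarrow> te ^ N b * q b = s * u b" by metis
  define K where "K = (\<Sum>b\<in>B. N b)"
  have K: "te ^ K * q b = s * (te ^ (K - N b) * u b)" if "b \<in> B" for b
  proof -
    have "N b \<le> K" unfolding K_def using fin that by (intro member_le_sum) auto
    then have "te ^ K = te ^ (K - N b) * te ^ N b" by (simp flip: power_add)
    then show ?thesis using N[OF that] by (simp add: mult.assoc mult.left_commute)
  qed
  have "te ^ K *s y \<in> span B"
  proof (rule mem_span_if_scale_eq[OF \<open>s \<noteq> 0\<close>])
    have "s *s te ^ K *s y = te ^ K *s s *s y" by (rule scale_left_commute)
    also have "\<dots> = (\<Sum>b\<in>B. (te ^ K * q b) *s b)"
      by (simp only: q scale_sum_right scale_scale)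
    finally show "s *s te ^ K *s y = (\<Sum>b\<in>B. (s * (te ^ (K - N b) * u b)) *s b)"
      using K by simp
  qed
  then show ?thesis unfolding te_def ..
qed

text \<open>Write \<open>x\<close> for the variable, so that \<open>x * q b = s * p b\<close>. The
  left side has no term free of \<open>v\<close>, so \<open>s\<close> kills the
  \<open>v\<close>-free part of \<open>p b\<close>, which is therefore zero; hence \<open>x\<close>
  divides \<open>p b\<close> and can be cancelled.\<close>

lemma variable_mem_span:
  assumes "monomial (Poly_Mapping.single v 1) *s y \<in> span B" and "s *s y \<in> span B" and "s \<noteq> 0"
    and s: "\<And>m. m \<in> Poly_Mapping.keys s \<Longrightarrow> Poly_Mapping.lookup m v = 0"
  shows "y \<in> span B"
proof -
  interpret monomial_weight "\<lambda>m :: 'n \<Rightarrow>\<^sub>0 nat. Poly_Mapping.lookup m v"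
    by (rule monomial_weight_lookup)
  define x :: "('n, 'k) polynomial" where "x = monomial (Poly_Mapping.single v 1)"
  obtain p where p: "x *s y = (\<Sum>b\<in>B. p b *s b)"
    using coordinates[OF assms(1)] unfolding x_def ..
  obtain q where q: "s *s y = (\<Sum>b\<in>B. q b *s b)"
    using coordinates[OF assms(2)] ..
  have "\<exists>u. p b = x * u" if "b \<in> B" for b
  proof -
    have eq: "x * q b = s * p b" by (rule cross_multiply[OF p q that])
    have "s * weight_part (\<lambda>m. Poly_Mapping.lookup m v) 0 (p b) =
        weight_part (\<lambda>m. Poly_Mapping.lookup m v) (0 + 0) (x * q b)"
      unfolding eq using s by (rule weight_part_mult_homogeneous[symmetric])
    also have "\<dots> = 0"
    proof (rule weight_part_eq_0)
      fix m assume "m \<in> Poly_Mapping.keys (x * q b)"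
      then show "Poly_Mapping.lookup m v \<noteq> 0 + 0"
        by (rule weight_keys_mult) (simp add: x_def)
    qed
    finally have "weight_part (\<lambda>m. Poly_Mapping.lookup m v) 0 (p b) = 0"
      using poly_mult_eq_0D \<open>s \<noteq> 0\<close> by blast
    then have "Poly_Mapping.lookup m v \<noteq> 0" if "m \<in> Poly_Mapping.keys (p b)" for m
      using that keys_weight_part[of "\<lambda>m. Poly_Mapping.lookup m v" 0 "p b"] by auto
    then show ?thesis unfolding x_def by (rule single_variable_dvd)
  qed
  then obtain u where u: "\<And>b. b \<in> B \<Longrightarrow> p b = x * u b" by metis
  show ?thesis
  proof (rule mem_span_if_scale_eq)
    show "x \<noteq> 0" by (simp add: x_def flip: keys_eq_empty)
    show "x *s y = (\<Sum>b\<in>B. (x * u b) *s b)" using p u by simp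
  qed
qed

text \<open>A polynomial that sends \<open>y\<close> into the span does the same to every multiple
  of \<open>y\<close>. So the witnesses for \<open>y\<close> also serve
  \<open>monomial l *s y\<close>, and one variable can be cancelled at each step.\<close>

lemma monomial_mem_span:
  assumes "monomial m *s y \<in> span B"
    and s: "\<And>v. \<exists>s. s \<noteq> 0 \<and> s *s y \<in> span B \<and> (\<forall>m\<in>Poly_Mapping.keys s. Poly_Mapping.lookup m v = 0)"
  shows "y \<in> span B"
  using assms(1)
proof (induction "total_degree m" arbitrary: m rule: less_induct)
  case less
  show ?case
  proof (cases "m = 0")
    case True
    then show ?thesis using less.prems by simp
  next
    case False
    then obtain v where v: "Poly_Mapping.lookup m v \<noteq> 0"
      by (metis lookup_zero poly_mapping_eqI)
    define l where "l = m - Poly_Mapping.single v 1"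
    have m: "m = Poly_Mapping.single v 1 + l"
      by (rule poly_mapping_eqI)
        (use v in \<open>auto simp: l_def lookup_add lookup_minus lookup_single when_def\<close>)
    obtain s where s: "s \<noteq> 0" "s *s y \<in> span B"
        "\<And>m. m \<in> Poly_Mapping.keys s \<Longrightarrow> Poly_Mapping.lookup m v = 0"
      using s by blast
    have "monomial l *s y \<in> span B"
    proof (rule variable_mem_span[OF _ _ s(1,3)])
      show "monomial (Poly_Mapping.single v 1) *s monomial l *s y \<in> span B"
        using less.prems by (simp add: m mult_single)
      show "s *s monomial l *s y \<in> span B"
        using span_scale[OF s(2), of "monomial l"] by (subst scale_left_commute)
    qed
    then show ?thesis by (rule less.hyps[rotated]) (simp add: m)
  qed
qed

text \<open>Passing to the leading part in a new variable and then to a power preserves homogeneity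
  in the variables already treated. Homogeneity in every variable leaves a scalar multiple of one
  monomial.\<close>

lemma ex_homogeneous_mem_span:
  assumes s: "\<And>v. \<exists>s. s \<noteq> 0 \<and> s *s y \<in> span B \<and> (\<forall>m\<in>Poly_Mapping.keys s. Poly_Mapping.lookup m v = 0)"
  shows "\<exists>t. t \<noteq> 0 \<and> t *s y \<in> span B \<and>
    (\<forall>v\<in>A. \<exists>a. \<forall>m\<in>Poly_Mapping.keys t. Poly_Mapping.lookup m v = a)"
  using finite[of A]
proof (induction A rule: finite_induct)
  case empty
  then show ?case using s by blast
next
  case (insert v A)
  let ?w = "\<lambda>v (m :: 'n \<Rightarrow>\<^sub>0 nat). Poly_Mapping.lookup m v"
  obtain t a where t: "t \<noteq> 0" "t *s y \<in> span B"
      "\<And>v m. v \<in> A \<Longrightarrow> m \<in> Poly_Mapping.keys t \<Longrightarrow> ?w v m = a v"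
    using insert.IH by metis
  obtain s where s: "s \<noteq> 0" "s *s y \<in> span B"
      "\<And>m. m \<in> Poly_Mapping.keys s \<Longrightarrow> ?w v m = 0"
    using s by blast
  define e where "e = Max (?w v ` Poly_Mapping.keys t)"
  define te where "te = weight_part (?w v) e t"
  obtain N where N: "te ^ N *s y \<in> span B"
    unfolding te_def
    using top_part_power_mem_span[OF t(2) s(2) s(1) s(3), of e] by (auto simp: e_def)
  have "e \<in> ?w v ` Poly_Mapping.keys t"
    unfolding e_def using t(1) by (intro Max_in) auto
  then have "Poly_Mapping.keys te \<noteq> {}"
    by (auto simp: te_def keys_weight_part)
  then have "te ^ N \<noteq> 0" by (intro poly_power_neq_0) auto
  moreover have "\<exists>a. \<forall>m\<in>Poly_Mapping.keys (te ^ N). ?w v' m = a" if "v' \<in> insert v A" for v'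
  proof (intro exI ballI)
    fix m assume "m \<in> Poly_Mapping.keys (te ^ N)"
    then show "?w v' m = N * (if v' = v then e else a v')"
      by (rule monomial_weight.homogeneous_power[OF monomial_weight_lookup, rotated])
        (use that t(3) in \<open>auto simp: te_def keys_weight_part\<close>)
  qed
  ultimately show ?case using N by blast
qed

text \<open>Used in contraposed form: an element outside the span yields a variable \<open>v\<close>
  such that no nonzero polynomial free of \<open>v\<close> multiplies it into the span.\<close>

lemma mem_span_if_free_of_each_variable:
  assumes s: "\<And>v. \<exists>s. s \<noteq> 0 \<and> s *s y \<in> span B \<and> (\<forall>m\<in>Poly_Mapping.keys s. Poly_Mapping.lookup m v = 0)"
  shows "y \<in> span B"
proof -
  obtain t a where t: "t \<noteq> 0" "t *s y \<in> span B"
      "\<And>v m. m \<in> Poly_Mapping.keys t \<Longrightarrow> Poly_Mapping.lookup m v = a v"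
    using ex_homogeneous_mem_span[of y UNIV] s by (metis UNIV_I)
  obtain l where l: "l \<in> Poly_Mapping.keys t"
    using t(1) by (metis keys_eq_empty ex_in_conv)
  have "m = l" if "m \<in> Poly_Mapping.keys t" for m
    by (rule poly_mapping_eqI) (simp add: t(3)[OF that] t(3)[OF l])
  with l have keys: "Poly_Mapping.keys t = {l}" by blast
  define c where "c = Poly_Mapping.lookup t l"
  have "c \<noteq> 0" using l by (simp add: c_def in_keys_iff)
  moreover have "t = Poly_Mapping.single l c"
    using sum_single_keys[of t] by (simp add: keys c_def)
  ultimately have "monomial l = const_poly (1 / c) * t"
    by (simp add: mult_single)
  then have "monomial l *s y = const_poly (1 / c) *s t *s y" by simp
  then have "monomial l *s y \<in> span B"
    using span_scale[OF t(2)] by metis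
  then show ?thesis by (rule monomial_mem_span[OF _ s])
qed

end

end

section \<open>Truncations of graded modules\<close>

lemma less_poly_mapping_lookup_0:
  fixes p q :: "nat \<Rightarrow>\<^sub>0 nat"
  assumes "p < q"
  shows "Poly_Mapping.lookup p 0 \<le> Poly_Mapping.lookup q 0"
proof -
  obtain k where "Poly_Mapping.lookup p k < Poly_Mapping.lookup q k"
      "\<And>k'. k' < k \<Longrightarrow> Poly_Mapping.lookup p k' = Poly_Mapping.lookup q k'"
    using assms by (auto simp: less_poly_mapping.rep_eq less_fun_def)
  then show ?thesis by (cases "k = 0") auto
qed

text \<open>
  Graded lexicographic order on pairs of a module generator and a monomial, obtained by embedding
  the pairs into the lexicographically ordered type \<^typ>\<open>nat \<Rightarrow>\<^sub>0 nat\<close> with the degree in position 0.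
\<close>

lemma ex_monomial_order:
  fixes E :: "'m set"
  assumes "finite E"
  obtains key :: "'m \<times> ('n::finite \<Rightarrow>\<^sub>0 nat) \<Rightarrow> (nat \<Rightarrow>\<^sub>0 nat)"
  where "inj_on key (E \<times> UNIV)"
    and "\<And>e m e' m'. key (e, m) < key (e', m') \<Longrightarrow> total_degree m \<le> total_degree m'"
    and "\<And>e m e' m' l. key (e, m) < key (e', m') \<Longrightarrow> key (e, l + m) < key (e', l + m')"
proof -
  obtain f :: "'n \<Rightarrow> nat" and N where f: "f ` UNIV = {i. i < N}" "inj f"
    using finite_imp_inj_to_nat_seg[OF finite[of "UNIV :: 'n set"]] by metis
  obtain g :: "'m \<Rightarrow> nat" where g: "inj_on g E"
    using finite_imp_inj_to_nat_seg[OF assms] by metis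
  \<comment> \<open>Position 0 holds the degree, positions \<open>1\<close> to \<open>N\<close> the
    exponents, and \<open>Suc N\<close> the generator as last tie-break. Multiplication by
    \<open>l\<close> adds \<open>mkey l\<close> to a key and so preserves the order.\<close>
  define mkey :: "('n \<Rightarrow>\<^sub>0 nat) \<Rightarrow> (nat \<Rightarrow>\<^sub>0 nat)" where
    "mkey m = Poly_Mapping.single 0 (total_degree m) +
      (\<Sum>v\<in>UNIV. Poly_Mapping.single (Suc (f v)) (Poly_Mapping.lookup m v))" for m
  define key where "key = (\<lambda>(e, m). mkey m + Poly_Mapping.single (Suc N) (g e))"
  have fN: "f v < N" for v using f(1) by blast
  have add: "mkey (l + m) = mkey l + mkey m" for l m
    by (simp add: mkey_def single_add lookup_add sum.distrib ac_simps)
  have key_add: "key (e, l + m) = mkey l + key (e, m)" for e l m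
    by (simp add: key_def add add.assoc)
  have at_0: "Poly_Mapping.lookup (key (e, m)) 0 = total_degree m" for e m
    by (simp add: key_def mkey_def lookup_add lookup_single lookup_sum when_def)
  have at_v: "Poly_Mapping.lookup (key (e, m)) (Suc (f v)) = Poly_Mapping.lookup m v" for e m v
    using fN[of v] injD[OF f(2)]
    by (simp add: key_def mkey_def lookup_add lookup_single lookup_sum when_def inj_eq[OF f(2)])
  have at_N: "Poly_Mapping.lookup (key (e, m)) (Suc N) = g e" for e m
    using fN by (simp add: key_def mkey_def lookup_add lookup_single lookup_sum when_def less_imp_neq)
  show thesis
  proof (rule that)
    show "inj_on key (E \<times> UNIV)"
    proof (rule inj_onI, clarify)
      fix e m e' m' assume *: "e \<in> E" "e' \<in> E" "key (e, m) = key (e', m')"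
      have "m = m'" using at_v *(3) by (intro poly_mapping_eqI) metis
      moreover have "e = e'" using at_N * g by (metis inj_onD)
      ultimately show "e = e' \<and> m = m'" by simp
    qed
    show "total_degree m \<le> total_degree m'" if "key (e, m) < key (e', m')" for e m e' m'
      using less_poly_mapping_lookup_0[OF that] by (simp add: at_0)
    show "key (e, l + m) < key (e', l + m')" if "key (e, m) < key (e', m')" for e m e' m' l
      using that by (simp add: key_add)
  qed
qed

section \<open>Products of generators and monomials\<close>

context graded_module
begin

definition act :: "'m \<times> ('n \<Rightarrow>\<^sub>0 nat) \<Rightarrow> 'm" where
  "act = (\<lambda>(e, m). monomial m *s e)"

text \<open>For \<open>T\<close> in degree 0 the k-span of this set is the part of
  \<open>span T\<close> in degrees up to \<open>n\<close>.\<close>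

definition truncation :: "'m set \<Rightarrow> nat \<Rightarrow> 'm set" where
  "truncation T n = act ` (T \<times> {m. total_degree m \<le> n})"

lemma finite_truncation [simp]: "finite T \<Longrightarrow> finite (truncation T n)"
  by (simp add: truncation_def finite_total_degree_le)

lemma truncation_mono: "n \<le> n' \<Longrightarrow> truncation T n \<subseteq> truncation T n'"
  by (force simp: truncation_def)

lemma scale_eq_sum_act:
  "p *s x = (\<Sum>m\<in>Poly_Mapping.keys p. const_poly (Poly_Mapping.lookup p m) *s act (x, m))"
proof -
  have "p *s x = (\<Sum>m\<in>Poly_Mapping.keys p. Poly_Mapping.single m (Poly_Mapping.lookup p m)) *s x"
    by (simp add: sum_single_keys)
  then show ?thesis
    by (simp add: scale_sum_left act_def mult_single)
qed

lemma scale_mem_kspan_act: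
  assumes "x \<in> T" and "Poly_Mapping.keys p \<subseteq> M"
  shows "p *s x \<in> kspace.span (act ` (T \<times> M))"
  using assms
  by (subst scale_eq_sum_act, intro kspace.span_sum kspace.span_scale, intro kspace.span_base) auto

lemma scale_mem_kspan_image:
  assumes "x \<in> kspace.span S"
  shows "p *s x \<in> kspace.span ((*s) p ` S)"
  using assms
proof (induction rule: kspace.span_induct_alt)
  case base
  then show ?case by (simp add: kspace.span_zero)
next
  case (step c x y)
  have "p *s (const_poly c *s x + y) = const_poly c *s (p *s x) + p *s y"
    by (simp add: scale_right_distrib mult.commute)
  then show ?case
    using step by (metis imageI kspace.span_add kspace.span_base kspace.span_scale)
qed

lemma scale_mem_kspan_truncation:
  assumes "x \<in> kspace.span (truncation T n)"
    and "\<And>m. m \<in> Poly_Mapping.keys p \<Longrightarrow> total_degree m \<le> a"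
  shows "p *s x \<in> kspace.span (truncation T (a + n))"
proof -
  have "(*s) p ` truncation T n \<subseteq> kspace.span (truncation T (a + n))"
  proof
    fix y assume "y \<in> (*s) p ` truncation T n"
    then obtain e m where em: "e \<in> T" "total_degree m \<le> n" "y = p *s monomial m *s e"
      by (auto simp: truncation_def act_def)
    have "Poly_Mapping.keys (p * monomial m) \<subseteq> {m. total_degree m \<le> a + n}"
      using keys_mult[of p "monomial m"] assms(2) em(2) by (force intro: add_mono)
    then show "y \<in> kspace.span (truncation T (a + n))"
      unfolding truncation_def em(3) scale_scale by (rule scale_mem_kspan_act[OF em(1)])
  qed
  then have "kspace.span ((*s) p ` truncation T n) \<subseteq> kspace.span (truncation T (a + n))"
    by (intro kspace.span_minimal kspace.subspace_span)
  then show ?thesis using scale_mem_kspan_image[OF assms(1)] by blast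
qed

lemma mem_span_imp_mem_kspan_truncation:
  assumes "x \<in> span T"
  shows "\<exists>n. x \<in> kspace.span (truncation T n)"
  using assms
proof (induction rule: span_induct_alt)
  case base
  then show ?case by (auto intro: kspace.span_zero)
next
  case (step c x y)
  then obtain n where n: "y \<in> kspace.span (truncation T n)" by blast
  define a where "a = (\<Sum>m\<in>Poly_Mapping.keys c. total_degree m)"
  have "c *s x \<in> kspace.span (truncation T a)"
    unfolding truncation_def
    by (rule scale_mem_kspan_act[OF step.hyps(1)]) (auto simp: a_def intro: member_le_sum)
  then have "c *s x + y \<in> kspace.span (truncation T (max a n))"
    using n kspace.span_mono[OF truncation_mono[of a "max a n" T]]
      kspace.span_mono[OF truncation_mono[of n "max a n" T]]
    by (intro kspace.span_add) auto
  then show ?case ..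
qed

lemma span_eq_kspan_act: "span T = kspace.span (act ` (T \<times> UNIV))"
proof (intro equalityI subsetI)
  fix x assume "x \<in> span T"
  then obtain n where "x \<in> kspace.span (truncation T n)"
    using mem_span_imp_mem_kspan_truncation by blast
  moreover have "truncation T n \<subseteq> act ` (T \<times> UNIV)" by (auto simp: truncation_def)
  ultimately show "x \<in> kspace.span (act ` (T \<times> UNIV))" using kspace.span_mono by blast
next
  fix x assume "x \<in> kspace.span (act ` (T \<times> UNIV))"
  then show "x \<in> span T"
    by (induction rule: kspace.span_induct_alt)
      (auto simp: act_def span_zero intro!: span_add span_scale intro: span_base)
qed

text \<open>Collecting the scalars at each \<open>e\<close> into a polynomial turns a k-linear
  relation into an R-linear one. The set \<open>L e\<close> varies with \<open>e\<close> because in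
  the decisive estimate one generator is multiplied only by monomials free of one variable.\<close>

lemma act_family_independent:
  assumes "finite T" and "\<And>e. e \<in> T \<Longrightarrow> finite (L e)"
    and indep: "\<And>p e. (\<And>e. Poly_Mapping.keys (p e) \<subseteq> L e) \<Longrightarrow>
      (\<Sum>e\<in>T. p e *s e) = 0 \<Longrightarrow> e \<in> T \<Longrightarrow> p e = 0"
    and sum: "(\<Sum>i\<in>Sigma T L. const_poly (c i) *s act i) = 0" and i: "i \<in> Sigma T L"
  shows "c i = 0"
proof -
  obtain e m where em: "i = (e, m)" "e \<in> T" "m \<in> L e" using i by blast
  define p where "p e = (\<Sum>m\<in>L e. Poly_Mapping.single m (c (e, m)))" for e
  have lookup: "Poly_Mapping.lookup (p e) m = (c (e, m) when m \<in> L e)" if "finite (L e)" for e m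
    using that by (auto simp: p_def lookup_sum lookup_single when_def)
  have keys: "Poly_Mapping.keys (p e) \<subseteq> L e" for e
  \<comment> \<open>Outside \<open>T\<close> the set \<open>L e\<close> may be infinite; the sum
    defining \<open>p e\<close> is then \<open>0\<close> by default.\<close>
  proof (cases "finite (L e)")
    case True
    then show ?thesis by (auto simp: in_keys_iff lookup when_def split: if_splits)
  qed (simp add: p_def)
  have "(\<Sum>e\<in>T. p e *s e) = (\<Sum>i\<in>Sigma T L. const_poly (c i) *s act i)"
    using assms(1,2)
    by (simp add: p_def scale_sum_left act_def mult_single sum.Sigma case_prod_beta)
  then have "p e = 0" using sum by (intro indep[OF keys _ em(2)]) simp
  then show ?thesis using lookup[of e m] assms(2) em by simp
qed

lemma subspace_component: "kspace.subspace (G j)"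
proof (rule kspace.subspaceI)
  show "x + y \<in> G j" if "x \<in> G j" "y \<in> G j" for x y
    using diff_component[OF that(1) diff_component[OF zero_component that(2)]] by simp
  show "const_poly c *s x \<in> G j" if "x \<in> G j" for c x
    using scale_component[OF _ that, of "const_poly c" 0] by (simp add: homogeneous_part_def)
qed (rule zero_component)

lemma act_component:
  assumes "e \<in> G 0"
  shows "act (e, m) \<in> G (int (total_degree m))"
  using scale_component[OF _ assms, of "monomial m" "total_degree m"]
  by (simp add: act_def homogeneous_part_def)

lemma components_eq_0:
  assumes "finite J" and "\<And>j. j \<in> J \<Longrightarrow> y j \<in> G j" and "(\<Sum>j\<in>J. y j) = 0" and "j \<in> J"
  shows "y j = 0"
proof -
  define c where "c j = (if j \<in> J then y j else 0)" for j
  have "finite {j. c j \<noteq> 0}"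
    using assms(1) by (rule rev_finite_subset) (auto simp: c_def)
  moreover have "(\<Sum>j | c j \<noteq> 0. c j) = (\<Sum>j\<in>J. y j)"
    using assms(1) by (intro sum.mono_neutral_cong_left) (auto simp: c_def)
  moreover define P where
    "P c \<longleftrightarrow> (\<forall>j. c j \<in> G j) \<and> finite {j. c j \<noteq> 0} \<and> 0 = (\<Sum>j | c j \<noteq> 0. c j)" for c
  ultimately have "P c" "P (\<lambda>_. 0)"
    using assms(2,3) zero_component by (simp_all add: c_def)
  moreover have "\<exists>!c. P c" unfolding P_def by (rule direct_sum)
  ultimately have "c = (\<lambda>_. 0)" by blast
  then have "c j = 0" by simp
  then show ?thesis using assms(4) by (simp add: c_def)
qed

text \<open>The summation bound is left open so that two decompositions can be added without
  matching their lengths.\<close>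

lemma kspan_act_decompose:
  assumes "x \<in> kspace.span (act ` (T \<times> M))"
  shows "\<exists>y N. (\<forall>i. y i \<in> kspace.span (act ` (T \<times> {m \<in> M. total_degree m = i}))) \<and>
    (\<forall>n\<ge>N. x = (\<Sum>i\<le>n. y i))"
  using assms
proof (induction rule: kspace.span_induct_alt)
  case base
  show ?case by (intro exI[of _ "\<lambda>_. 0"]) (simp add: kspace.span_zero)
next
  case (step c x z)
  then obtain y N where y: "\<And>i. y i \<in> kspace.span (act ` (T \<times> {m \<in> M. total_degree m = i}))"
      "\<And>n. n \<ge> N \<Longrightarrow> z = (\<Sum>i\<le>n. y i)"
    by blast
  obtain e m where em: "e \<in> T" "m \<in> M" "x = act (e, m)" using step.hyps(1) by auto
  define y' where "y' i = (if i = total_degree m then const_poly c *s x else 0) + y i" for i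
  have "y' i \<in> kspace.span (act ` (T \<times> {m \<in> M. total_degree m = i}))" for i
    unfolding y'_def using em
    by (intro kspace.span_add y(1))
      (auto intro!: kspace.span_scale[OF kspace.span_base] simp: kspace.span_zero)
  moreover have "const_poly c *s x + z = (\<Sum>i\<le>n. y' i)" if "n \<ge> max N (total_degree m)" for n
    using that y(2)[of n] by (simp add: y'_def sum.distrib)
  ultimately show ?case by blast
qed

text \<open>As \<open>T\<close> sits in degree 0, sorting a combination by monomial degree is the
  same as decomposing it in the grading; for \<open>x\<close> in \<open>G j\<close> only the summand
  of degree \<open>j\<close> survives.\<close>

lemma kspan_act_component:
  assumes T: "T \<subseteq> G 0" and x: "x \<in> kspace.span (act ` (T \<times> M))" "x \<in> G j"
  shows "x \<in> kspace.span (act ` (T \<times> {m \<in> M. int (total_degree m) = j}))"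
proof -
  obtain y N where y: "\<And>i. y i \<in> kspace.span (act ` (T \<times> {m \<in> M. total_degree m = i}))"
      "\<And>n. n \<ge> N \<Longrightarrow> x = (\<Sum>i\<le>n. y i)"
    using kspan_act_decompose[OF x(1)] by blast
  have yG: "y i \<in> G (int i)" for i
  proof -
    have "kspace.span (act ` (T \<times> {m \<in> M. total_degree m = i})) \<subseteq> G (int i)"
      using T act_component by (intro kspace.span_minimal subspace_component) auto
    then show ?thesis using y(1) by blast
  qed
  define n where "n = max N (nat j)"
  define u where "u k = (if k = j then x else 0)" for k
  define z where "z k = (if k \<in> int ` {..n} then y (nat k) else 0)" for k
  define J where "J = insert j (int ` {..n})"
  have "(\<Sum>k\<in>J. z k) = (\<Sum>k\<in>int ` {..n}. y (nat k))"
    by (intro sum.mono_neutral_cong_right) (auto simp: J_def z_def)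
  also have "\<dots> = (\<Sum>i\<le>n. y i)" by (simp add: sum.reindex)
  also have "\<dots> = x" using y(2)[of n] by (simp add: n_def)
  finally have "(\<Sum>k\<in>J. u k - z k) = 0"
    by (simp add: sum_subtractf u_def J_def)
  moreover have "u k - z k \<in> G k" for k
    using x(2) yG zero_component by (intro diff_component) (auto simp: u_def z_def)
  ultimately have "u j - z j = 0"
    by (intro components_eq_0[where J = J and y = "\<lambda>k. u k - z k"]) (auto simp: J_def)
  then have xz: "x = z j" by (simp add: u_def)
  show ?thesis
  proof (cases "j \<in> int ` {..n}")
    case True
    then obtain i where "j = int i" by auto
    then show ?thesis using xz True y(1)[of i] by (simp add: z_def)
  next
    case False
    then show ?thesis using xz by (simp add: z_def kspace.span_zero)
  qed
qed

end

section \<open>Modules generated in degree 0\<close>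

locale standard_graded_module = graded_module scale G
  for scale :: "('n::finite, 'k::field) polynomial \<Rightarrow> 'm::ab_group_add \<Rightarrow> 'm"  (infixr \<open>*s\<close> 75)
  and G :: "int \<Rightarrow> 'm set" +
  assumes fg: finitely_generated
    and gen: "span (G 0) = UNIV"
begin

text \<open>Finite generation yields a finite part \<open>E'\<close> of a k-basis \<open>E\<close>
  of \<open>G 0\<close> that generates over R. In degree 0 only constants act, so \<open>E'\<close>
  already spans \<open>G 0\<close> over k and bounds the size of \<open>E\<close>.\<close>

lemma ex_finite_component_basis:
  "\<exists>E. finite E \<and> E \<subseteq> G 0 \<and> kspace.independent E \<and> span E = UNIV"
proof -
  obtain E where E: "E \<subseteq> G 0" "kspace.independent E" "G 0 \<subseteq> kspace.span E"
    using kspace.maximal_independent_subset by blast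
  have "kspace.span E \<subseteq> span E"
    using span_scale by (intro kspace.span_minimal kspace.subspaceI)
      (auto intro: span_base span_add span_zero)
  then have "span (G 0) \<subseteq> span E"
    using E(3) by (intro span_minimal) auto
  then have spE: "span E = UNIV" using gen by auto
  obtain S where S: "finite S" "span S = UNIV" using fg by (auto simp: finitely_generated_def)
  have "\<exists>t. finite t \<and> t \<subseteq> E \<and> s \<in> span t" for s
  proof -
    have "s \<in> span E" by (simp add: spE)
    then obtain t r where "finite t" "t \<subseteq> E" "s = (\<Sum>a\<in>t. r a *s a)"
      by (auto simp: span_explicit)
    then show ?thesis by (auto intro!: exI[of _ t] span_sum span_scale intro: span_base)
  qed
  then obtain t where t: "\<And>s. finite (t s)" "\<And>s. t s \<subseteq> E" "\<And>s. s \<in> span (t s)" by metis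
  define E' where "E' = (\<Union>s\<in>S. t s)"
  have E': "finite E'" "E' \<subseteq> E" using S(1) t by (auto simp: E'_def)
  have "S \<subseteq> span E'"
    using t(3) span_mono[of "t _" E'] by (fastforce simp: E'_def)
  then have "span E' = UNIV" using S(2) span_minimal[of S "span E'"] by auto
  then have "x \<in> kspace.span (act ` (E' \<times> {m \<in> UNIV. int (total_degree m) = 0}))" if "x \<in> G 0" for x
    using that E' E(1) by (intro kspan_act_component) (auto simp flip: span_eq_kspan_act)
  moreover have "act ` (E' \<times> {m \<in> UNIV. int (total_degree m) = 0}) \<subseteq> E'"
  proof
    fix x assume "x \<in> act ` (E' \<times> {m \<in> UNIV. int (total_degree m) = 0})"
    then obtain e m where em: "e \<in> E'" "total_degree m = 0" "x = act (e, m)" by auto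
    have "m = 0"
      by (rule poly_mapping_eqI) (use lookup_le_total_degree[of m] em(2) in auto)
    then show "x \<in> E'" using em by (simp add: act_def)
  qed
  ultimately have "G 0 \<subseteq> kspace.span E'" using kspace.span_mono by blast
  then have "finite E"
    using kspace.independent_span_bound[OF E'(1) E(2)] E(1) by auto
  then show ?thesis using E spE by blast
qed

context
  fixes E
  assumes finE: "finite E" and E0: "E \<subseteq> G 0" and spE: "span E = UNIV"
begin

lemma component_eq_kspan:
  "G j = kspace.span (act ` (E \<times> {m. int (total_degree m) = j}))"
proof
  show "kspace.span (act ` (E \<times> {m. int (total_degree m) = j})) \<subseteq> G j"
    using E0 act_component by (intro kspace.span_minimal subspace_component) auto
  show "G j \<subseteq> kspace.span (act ` (E \<times> {m. int (total_degree m) = j}))"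
    using kspan_act_component[OF E0, of _ UNIV j] spE by (auto simp: span_eq_kspan_act)
qed

text \<open>Negative components vanish, and each truncation grows by the next component, which meets
  it trivially.\<close>

lemma cumulative_hilbert_eq_dim: "cumulative_hilbert n = kspace.dim (truncation E n)"
proof -
  define S where "S i = act ` (E \<times> {m. total_degree m = i})" for i
  have G: "G (int i) = kspace.span (S i)" for i
    unfolding component_eq_kspan S_def by simp
  have G_neg: "G j = {0}" if "j < 0" for j
  proof -
    have empty: "{m :: 'n \<Rightarrow>\<^sub>0 nat. int (total_degree m) = j} = {}" using that by auto
    show ?thesis unfolding component_eq_kspan empty by simp
  qed
  have "cumulative_hilbert n = (\<Sum>j\<in>int ` {..n}. kspace.dim (G j))"
    unfolding cumulative_hilbert_def
  proof (rule sum.mono_neutral_left)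
    show "{j. j \<le> int n \<and> G j \<noteq> {0}} \<subseteq> int ` {..n}"
    proof
      fix j assume j: "j \<in> {j. j \<le> int n \<and> G j \<noteq> {0}}"
      then have "j \<ge> 0" using G_neg not_less by blast
      then show "j \<in> int ` {..n}" using j by (intro image_eqI[of _ _ "nat j"]) auto
    qed
    show "\<forall>j\<in>int ` {..n} - {j. j \<le> int n \<and> G j \<noteq> {0}}. kspace.dim (G j) = 0"
      using kspace.dim_eq_card_independent[OF kspace.independent_empty]
        kspace.dim_span[of "{}"] by auto
  qed simp
  also have "\<dots> = (\<Sum>i\<le>n. kspace.dim (S i))"
    by (simp add: sum.reindex G)
  also have "\<dots> = kspace.dim (truncation E n)"
  proof (induction n)
    case 0
    then show ?case by (simp add: S_def truncation_def)
  next
    case (Suc n)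
    have "kspace.span (truncation E n) \<inter> kspace.span (S (Suc n)) \<subseteq> {0}"
    proof
      fix x assume "x \<in> kspace.span (truncation E n) \<inter> kspace.span (S (Suc n))"
      then have "x \<in> kspace.span (act ` (E \<times> {m. total_degree m \<le> n}))" "x \<in> G (int (Suc n))"
        by (simp_all add: G truncation_def del: of_nat_Suc)
      then have "x \<in> kspace.span (act ` (E \<times> {m \<in> {m. total_degree m \<le> n}.
          int (total_degree m) = int (Suc n)}))"
        by (rule kspan_act_component[OF E0])
      moreover have "{m \<in> {m :: 'n \<Rightarrow>\<^sub>0 nat. total_degree m \<le> n}.
          int (total_degree m) = int (Suc n)} = {}"
        by (auto simp del: of_nat_Suc)
      ultimately show "x \<in> {0}"
        by (simp only: Sigma_empty2 image_empty kspace.span_empty)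
    qed
    then have "kspace.span (truncation E n) \<inter> kspace.span (S (Suc n)) = {0}"
      using kspace.span_zero by blast
    moreover have "finite (S (Suc n))"
      unfolding S_def using finE
      by (intro finite_imageI finite_cartesian_product finite_subset[OF _ finite_total_degree_le[of "Suc n"]])
        auto
    ultimately have "kspace.dim (truncation E n \<union> S (Suc n)) =
        kspace.dim (truncation E n) + kspace.dim (S (Suc n))"
      using finE by (intro kspace.dim_Un_direct) auto
    moreover have "truncation E (Suc n) = truncation E n \<union> S (Suc n)"
      by (auto simp: truncation_def S_def le_Suc_eq)
    ultimately show ?case using Suc by simp
  qed
  finally show ?thesis .
qed

text \<open>
  The standard monomials, those which are not combinations of smaller ones, form a basis of
  each truncation, and multiples of non-standard monomials are non-standard.
\<close>

lemma binomial_type_cumulative_hilbert: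
  "binomial_type CARD('n) (\<lambda>n. int (cumulative_hilbert n))"
proof -
  obtain key :: "'m \<times> ('n \<Rightarrow>\<^sub>0 nat) \<Rightarrow> (nat \<Rightarrow>\<^sub>0 nat)"
    where inj: "inj_on key (E \<times> UNIV)"
      and deg: "\<And>e m e' m'. key (e, m) < key (e', m') \<Longrightarrow> total_degree m \<le> total_degree m'"
      and mult: "\<And>e m e' m' l. key (e, m) < key (e', m') \<Longrightarrow> key (e, l + m) < key (e', l + m')"
    using ex_monomial_order[OF finE] by blast
  define below where "below i = act ` {j \<in> E \<times> UNIV. key j < key i}" for i
  define D where "D e = {m. act (e, m) \<notin> kspace.span (below (e, m))}" for e
  have "down_closed (D e)" for e
    unfolding down_closed_def
  proof (intro allI impI, rule ccontr)
    fix l m assume lm: "l + m \<in> D e" and "m \<notin> D e"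
    then have "act (e, m) \<in> kspace.span (below (e, m))" by (simp add: D_def)
    then have "monomial l *s act (e, m) \<in> kspace.span ((*s) (monomial l) ` below (e, m))"
      by (rule scale_mem_kspan_image)
    moreover have act: "monomial l *s act (e', m') = act (e', l + m')" for e' m'
      by (simp add: act_def mult_single)
    have "(*s) (monomial l) ` below (e, m) \<subseteq> below (e, l + m)"
    proof
      fix y assume "y \<in> (*s) (monomial l) ` below (e, m)"
      then obtain e' m' where "e' \<in> E" "key (e', m') < key (e, m)" "y = act (e', l + m')"
        by (auto simp: below_def act)
      then show "y \<in> below (e, l + m)" using mult[of e' m' e m l] by (auto simp: below_def)
    qed
    ultimately have "act (e, l + m) \<in> kspace.span (below (e, l + m))"
      using kspace.span_mono unfolding act by blast
    with lm show False by (simp add: D_def)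
  qed
  then have "binomial_type (card (UNIV :: 'n set))
      (\<lambda>n. \<Sum>e\<in>E. int (card (monomials_upto UNIV (D e) n)))"
    by (intro binomial_type_sum binomial_type_down_closed)
  moreover have "int (cumulative_hilbert n) = (\<Sum>e\<in>E. int (card (monomials_upto UNIV (D e) n)))" for n
  proof -
    define I where "I = E \<times> {m :: 'n \<Rightarrow>\<^sub>0 nat. total_degree m \<le> n}"
    have "below i = act ` {j \<in> I. key j < key i}" if "i \<in> I" for i
    proof -
      \<comment> \<open>A pair with smaller key has no larger degree, so cutting off at degree
        \<open>n\<close> loses no predecessor and one set \<open>D e\<close> serves all
        \<open>n\<close>.\<close>
      have "{j \<in> E \<times> UNIV. key j < key i} = {j \<in> I. key j < key i}"
        using that deg by (auto simp: I_def) (meson le_trans)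
      then show ?thesis by (simp add: below_def)
    qed
    then have "{i \<in> I. act i \<notin> kspace.span (act ` {j \<in> I. key j < key i})} =
        {i \<in> I. act i \<notin> kspace.span (below i)}"
      by auto
    also have "\<dots> = Sigma E (\<lambda>e. monomials_upto UNIV (D e) n)"
      by (auto simp: I_def D_def monomials_upto_def)
    finally have "kspace.dim (act ` I) = card (Sigma E (\<lambda>e. monomials_upto UNIV (D e) n))"
      using kspace.dim_greedy[of I key act] inj_on_subset[OF inj, of I] finE
      by (auto simp: I_def finite_total_degree_le)
    then show ?thesis
      using finE by (simp add: cumulative_hilbert_eq_dim truncation_def I_def)
  qed
  ultimately show ?thesis by simp
qed

end

end

section \<open>Hilbert coefficients and freeness\<close>

context graded_module
begin

lemma is_hilbert_coeffs_iff:
  "is_hilbert_coeffs e \<longleftrightarrow> (\<forall>\<^sub>F n in sequentially. int (cumulative_hilbert n) =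
     (\<Sum>j\<le>CARD('n). (- 1) ^ (CARD('n) - j) * e (CARD('n) - j) * int ((n + j) choose j)))"
proof -
  have "(\<Sum>i\<le>d. (- 1) ^ i * e i * int ((n + (d - i)) choose (d - i))) =
      (\<Sum>j\<le>d. (- 1) ^ (d - j) * e (d - j) * int ((n + j) choose j))" for n d
    by (rule sum.reindex_bij_witness[of _ "\<lambda>i. d - i" "\<lambda>i. d - i"]) auto
  then show ?thesis by (simp only: is_hilbert_coeffs_def)
qed

lemma hilbert_coeff_eqI:
  assumes e: "is_hilbert_coeffs e" "\<And>i. i > CARD('n) \<Longrightarrow> e i = 0"
  shows "hilbert_coeff = e"
  unfolding hilbert_coeff_def
proof (rule the_equality)
  show "is_hilbert_coeffs e \<and> (\<forall>i>CARD('n). e i = 0)" using e by blast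
  fix e' assume e': "is_hilbert_coeffs e' \<and> (\<forall>i>CARD('n). e' i = 0)"
  let ?d = "CARD('n)"
  have "\<forall>\<^sub>F n in sequentially.
      (\<Sum>j\<le>?d. (- 1) ^ (?d - j) * e' (?d - j) * int ((n + j) choose j)) =
      (\<Sum>j\<le>?d. (- 1) ^ (?d - j) * e (?d - j) * int ((n + j) choose j))"
    using e(1) conjunct1[OF e'] unfolding is_hilbert_coeffs_iff by eventually_elim simp
  then have "(- 1) ^ (?d - j) * e' (?d - j) = (- 1) ^ (?d - j) * e (?d - j)" if "j \<le> ?d" for j
    using that by (rule binomial_sum_unique)
  then have *: "e' (?d - j) = e (?d - j)" if "j \<le> ?d" for j
    using that by simp
  show "e' = e"
  proof
    fix i
    show "e' i = e i"
    proof (cases "i \<le> ?d")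
      case True
      then show ?thesis using *[of "?d - i"] by simp
    next
      case False
      then show ?thesis using e(2) e' by simp
    qed
  qed
qed

lemma is_hilbert_coeffs_hilbert_coeff:
  assumes "binomial_type CARD('n) (\<lambda>n. int (cumulative_hilbert n))"
  shows "is_hilbert_coeffs hilbert_coeff"
proof -
  let ?d = "CARD('n)"
  obtain c where c: "\<forall>\<^sub>F n in sequentially. int (cumulative_hilbert n) =
      (\<Sum>j\<le>?d. c j * int ((n + j) choose j))"
    using assms by (auto simp: binomial_type_def)
  define e where "e i = (if i \<le> ?d then (- 1) ^ i * c (?d - i) else 0)" for i
  have "(- 1) ^ (?d - j) * e (?d - j) = c j" if "j \<le> ?d" for j
    using that by (simp add: e_def flip: mult.assoc power_add power_mult_distrib mult_2)
  then have "is_hilbert_coeffs e"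
    using c unfolding is_hilbert_coeffs_iff by simp
  moreover have "hilbert_coeff = e"
    using calculation by (rule hilbert_coeff_eqI) (simp add: e_def)
  ultimately show ?thesis by simp
qed

end

section \<open>Rank, growth and freeness\<close>

locale torsion_free_graded_module = standard_graded_module scale G + torsion_free_module scale
  for scale :: "('n::finite, 'k::field) polynomial \<Rightarrow> 'm::ab_group_add \<Rightarrow> 'm"  (infixr \<open>*s\<close> 75)
  and G :: "int \<Rightarrow> 'm set"
begin

text \<open>Over a ring, maximality gives spanning only up to a multiplier: a relation on
  \<open>insert e B\<close> must involve \<open>e\<close>, and its coefficient there is the
  multiplier.\<close>

lemma ex_maximal_independent_subset:
  assumes "finite E"
  shows "\<exists>B\<subseteq>E. independent B \<and> (\<forall>e\<in>E. \<exists>a. a \<noteq> 0 \<and> a *s e \<in> span B)"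
proof -
  define \<I> where "\<I> = {B. B \<subseteq> E \<and> independent B}"
  have "\<exists>B\<in>\<I>. \<forall>B'\<in>\<I>. B \<subseteq> B' \<longrightarrow> B = B'"
    by (rule finite_has_maximal) (use assms independent_empty in \<open>auto simp: \<I>_def\<close>)
  then obtain B where "B \<in> \<I>" and "\<forall>B'\<in>\<I>. B \<subseteq> B' \<longrightarrow> B = B'" ..
  then have B: "B \<subseteq> E" "independent B"
      and max: "\<And>B'. B' \<subseteq> E \<Longrightarrow> independent B' \<Longrightarrow> B \<subseteq> B' \<Longrightarrow> B = B'"
    by (simp_all add: \<I>_def)
  have "\<exists>a. a \<noteq> 0 \<and> a *s e \<in> span B" if "e \<in> E" for e
  proof (cases "e \<in> B")
    case True
    then show ?thesis by (intro exI[of _ 1]) (simp add: span_base)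
  next
    case False
    then have "dependent (insert e B)" using max[of "insert e B"] B that by auto
    then obtain t u x where t: "finite t" "t \<subseteq> insert e B" "(\<Sum>v\<in>t. u v *s v) = 0"
        "x \<in> t" "u x \<noteq> 0"
      unfolding dependent_explicit by blast
    have rest: "t - {e} \<subseteq> B" using t(2) by auto
    have "e \<in> t \<and> u e \<noteq> 0"
    proof (rule ccontr)
      assume *: "\<not> (e \<in> t \<and> u e \<noteq> 0)"
      then have "(\<Sum>v\<in>t - {e}. u v *s v) = (\<Sum>v\<in>t. u v *s v)"
        using t(1) by (intro sum.mono_neutral_left) auto
      moreover have "x \<in> t - {e}" using * t(4,5) by auto
      ultimately show False
        using independentD[OF B(2) _ rest, of u x] t by simp
    qed
    then have e: "e \<in> t" "u e \<noteq> 0" by auto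
    have "u e *s e = - (\<Sum>v\<in>t - {e}. u v *s v)"
      using t(3) sum.remove[OF t(1) e(1), of "\<lambda>v. u v *s v"] by (simp add: eq_neg_iff_add_eq_0)
    also have "\<dots> \<in> span B"
      using rest by (intro span_neg span_sum span_scale span_base) auto
    finally show ?thesis using e(2) by blast
  qed
  then show ?thesis using B by blast
qed

lemma ex_common_truncation:
  assumes "finite C" and "\<And>x. x \<in> C \<Longrightarrow> f x \<in> span T"
  shows "\<exists>N. \<forall>x\<in>C. f x \<in> kspace.span (truncation T N)"
proof -
  obtain N where N: "\<And>x. x \<in> C \<Longrightarrow> f x \<in> kspace.span (truncation T (N x))"
    using bchoice[of C "\<lambda>x n. f x \<in> kspace.span (truncation T n)"]
      mem_span_imp_mem_kspan_truncation[OF assms(2)] by blast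
  have "f x \<in> kspace.span (truncation T (\<Sum>x\<in>C. N x))" if "x \<in> C" for x
    using N[OF that] kspace.span_mono[OF truncation_mono[OF member_le_sum[OF that, of N]]] assms(1)
    by blast
  then show ?thesis by blast
qed

lemma card_truncation_le:
  "finite T \<Longrightarrow> card (truncation T n) \<le> card T * ((n + CARD('n)) choose CARD('n))"
  unfolding truncation_def
  by (rule card_image_le[THEN order_trans])
    (auto simp: finite_total_degree_le card_cartesian_product card_total_degree_le)

text \<open>The product \<open>s\<close> of the multipliers sends all of \<open>E\<close> into
  \<open>span B\<close>, and multiplication by \<open>s\<close> is injective. It embeds the
  truncation at \<open>n\<close> into that of \<open>B\<close> at \<open>n + N\<close>, where
  \<open>N\<close> bounds the degrees needed for \<open>s *s e\<close>.\<close>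

lemma dim_truncation_le:
  assumes E: "finite E" and B: "finite B"
    and alg: "\<And>e. e \<in> E \<Longrightarrow> \<exists>a. a \<noteq> 0 \<and> a *s e \<in> span B"
  shows "\<exists>N. \<forall>n. kspace.dim (truncation E n) \<le> card B * ((n + N + CARD('n)) choose CARD('n))"
proof -
  obtain a where a: "\<And>e. e \<in> E \<Longrightarrow> a e \<noteq> 0" "\<And>e. e \<in> E \<Longrightarrow> a e *s e \<in> span B"
    using alg by metis
  define s where "s = (\<Prod>e\<in>E. a e)"
  have "s \<noteq> 0" unfolding s_def using E a(1) by (rule poly_prod_neq_0)
  have "s *s e \<in> span B" if "e \<in> E" for e
  proof -
    have "s *s e = (\<Prod>e\<in>E - {e}. a e) *s a e *s e"
      using E that by (simp add: s_def prod.remove mult.commute)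
    then show ?thesis using span_scale[OF a(2)[OF that]] by simp
  qed
  then obtain N where N: "\<And>e. e \<in> E \<Longrightarrow> s *s e \<in> kspace.span (truncation B N)"
    using ex_common_truncation[OF E, of "\<lambda>e. s *s e" B] by blast
  have "kspace.dim (truncation E n) \<le> card B * ((n + N + CARD('n)) choose CARD('n))" for n
  proof -
    obtain C where C: "C \<subseteq> truncation E n" "kspace.independent C"
        "card C = kspace.dim (truncation E n)"
      using kspace.basis_exists by metis
    have finC: "finite C" using C(1) E finite_subset finite_truncation by blast
    have "card C \<le> kspace.dim (truncation B (n + N))"
    proof (rule kspace.card_family_le_dim[OF finC])
      fix c i assume c: "(\<Sum>i\<in>C. const_poly (c i) *s s *s i) = 0" and i: "i \<in> C"
      have "s *s (\<Sum>i\<in>C. const_poly (c i) *s i) = (\<Sum>i\<in>C. const_poly (c i) *s s *s i)"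
        by (simp add: scale_sum_right mult.commute)
      then have "(\<Sum>i\<in>C. const_poly (c i) *s i) = 0"
        using c \<open>s \<noteq> 0\<close> scale_eq_0D by metis
      then show "c i = 0" using kspace.independentD[OF C(2) finC] i by blast
    next
      show "(*s) s ` C \<subseteq> kspace.span (truncation B (n + N))"
      proof clarify
        fix x assume "x \<in> C"
        then obtain e m where em: "e \<in> E" "total_degree m \<le> n" "x = monomial m *s e"
          using C(1) by (auto simp: truncation_def act_def)
        have "monomial m *s s *s e \<in> kspace.span (truncation B (n + N))"
          using N[OF em(1)] em(2) by (intro scale_mem_kspan_truncation) auto
        then show "s *s x \<in> kspace.span (truncation B (n + N))"
          by (simp add: em(3) mult.commute)
      qed
    qed (use B in simp)
    also have "\<dots> \<le> card (truncation B (n + N))"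
      using B by (intro kspace.dim_le_card kspace.span_superset finite_truncation)
    also have "\<dots> \<le> card B * ((n + N + CARD('n)) choose CARD('n))"
      using card_truncation_le[OF B, of "n + N"] by simp
    finally show ?thesis by (simp add: C(3))
  qed
  then show ?thesis by blast
qed

lemma card_le_dim_truncation:
  assumes "finite E" and "finite T" and "\<And>e. e \<in> T \<Longrightarrow> finite (L e)"
    and "\<And>p e. (\<And>e. Poly_Mapping.keys (p e) \<subseteq> L e) \<Longrightarrow>
      (\<Sum>e\<in>T. p e *s e) = 0 \<Longrightarrow> e \<in> T \<Longrightarrow> p e = 0"
    and "\<And>e m. e \<in> T \<Longrightarrow> m \<in> L e \<Longrightarrow> act (e, m) \<in> kspace.span (truncation E n)"
  shows "(\<Sum>e\<in>T. card (L e)) \<le> kspace.dim (truncation E n)"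
proof -
  have "card (Sigma T L) \<le> kspace.dim (truncation E n)"
  proof (rule kspace.card_family_le_dim)
    show "finite (Sigma T L)" using assms(2,3) by simp
    show "c i = 0" if "(\<Sum>i\<in>Sigma T L. const_poly (c i) *s act i) = 0" "i \<in> Sigma T L" for c i
      using assms(2,3) _ that by (rule act_family_independent) (use assms(4) in blast)+
    show "act ` Sigma T L \<subseteq> kspace.span (truncation E n)" using assms(5) by auto
  qed (use assms(1) in simp)
  then show ?thesis using assms(2,3) by simp
qed

text \<open>The elements of \<open>C\<close> may be inhomogeneous but lie in some truncation, of
  level \<open>K\<close> say. Their products with monomials of degree at most \<open>n\<close> are
  independent and lie at level \<open>n + K\<close>, so growth compares the two
  cardinalities.\<close>

lemma card_independent_le:
  assumes E: "finite E" "span E = UNIV" and B: "finite B"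
    and alg: "\<And>e. e \<in> E \<Longrightarrow> \<exists>a. a \<noteq> 0 \<and> a *s e \<in> span B"
    and C: "finite C" "independent C"
  shows "card C \<le> card B"
proof -
  obtain N where N: "\<And>n. kspace.dim (truncation E n) \<le>
      card B * ((n + N + CARD('n)) choose CARD('n))"
    using dim_truncation_le[OF E(1) B alg] by blast
  obtain K where K: "\<And>x. x \<in> C \<Longrightarrow> x \<in> kspace.span (truncation E K)"
    using ex_common_truncation[OF C(1), of "\<lambda>x. x" E] E(2) by auto
  have "card C * ((n + CARD('n)) choose CARD('n)) \<le>
      card B * ((n + (K + N) + CARD('n)) choose CARD('n))" for n
  proof -
    have "(\<Sum>e\<in>C. card {m :: 'n \<Rightarrow>\<^sub>0 nat. total_degree m \<le> n}) \<le> kspace.dim (truncation E (n + K))"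
    proof (rule card_le_dim_truncation[OF E(1) C(1)])
      show "act (e, m) \<in> kspace.span (truncation E (n + K))"
        if "e \<in> C" "m \<in> {m. total_degree m \<le> n}" for e m
        using K[OF that(1)] that(2) unfolding act_def prod.case
        by (intro scale_mem_kspan_truncation) auto
    qed (use finite_total_degree_le independentD[OF C(2,1)] in auto)
    then show ?thesis
      using N[of "n + K"] by (simp add: card_total_degree_le add_ac)
  qed
  then show ?thesis by (rule mult_choose_shift_leD)
qed

lemma scale_mem_kspan_positive:
  assumes "span E = UNIV" and "Poly_Mapping.lookup q 0 = 0"
  shows "q *s x \<in> kspace.span (act ` (E \<times> {m. total_degree m \<noteq> 0}))"
proof -
  have "(*s) q ` act ` (E \<times> UNIV) \<subseteq> kspace.span (act ` (E \<times> {m. total_degree m \<noteq> 0}))"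
  proof clarify
    fix e m assume e: "e \<in> E"
    have "Poly_Mapping.keys (q * monomial m) \<subseteq> {m. total_degree m \<noteq> 0}"
    proof
      fix l assume "l \<in> Poly_Mapping.keys (q * monomial m)"
      then obtain l' where l: "l = l' + m" "l' \<in> Poly_Mapping.keys q"
        using keys_mult[of q "monomial m"] by auto
      then have "l' \<noteq> 0" using assms(2) by (auto simp: in_keys_iff)
      then obtain v where "Poly_Mapping.lookup l' v \<noteq> 0"
        by (metis lookup_zero poly_mapping_eqI)
      then have "total_degree l' \<noteq> 0" using lookup_le_total_degree[of l' v] by linarith
      then show "l \<in> {m. total_degree m \<noteq> 0}" by (simp add: l)
    qed
    then have "(q * monomial m) *s e \<in> kspace.span (act ` (E \<times> {m. total_degree m \<noteq> 0}))"
      by (rule scale_mem_kspan_act[OF e])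
    then show "q *s act (e, m) \<in> kspace.span (act ` (E \<times> {m. total_degree m \<noteq> 0}))"
      by (simp add: act_def)
  qed
  then have "kspace.span ((*s) q ` act ` (E \<times> UNIV)) \<subseteq>
      kspace.span (act ` (E \<times> {m. total_degree m \<noteq> 0}))"
    by (intro kspace.span_minimal kspace.subspace_span)
  moreover have "x \<in> kspace.span (act ` (E \<times> UNIV))"
    using assms(1) by (simp flip: span_eq_kspan_act)
  ultimately show ?thesis using scale_mem_kspan_image by blast
qed

text \<open>
  Expanding the elements of \<open>E\<close> in a basis \<open>C\<close> and keeping only the constant terms of the
  coefficients stays injective, since \<open>E\<close> lives in the lowest degree.
\<close>

lemma card_component_basis_le:
  assumes E: "finite E" "E \<subseteq> G 0" "kspace.independent E" "span E = UNIV"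
    and C: "finite C" "independent C" "span C = UNIV"
  shows "card E \<le> card C"
proof -
  have "\<exists>p. x = (\<Sum>b\<in>C. p b *s b)" for x
    using coordinates[OF C(1,2), of x] C(3) by simp
  then obtain p where p: "\<And>x. x = (\<Sum>b\<in>C. p x b *s b)" by metis
  define v where "v x = (\<Sum>b\<in>C. const_poly (Poly_Mapping.lookup (p x b) 0) *s b)" for x
  have "card E \<le> kspace.dim C"
  proof (rule kspace.card_family_le_dim[OF E(1)])
    fix c i assume c: "(\<Sum>x\<in>E. const_poly (c x) *s v x) = 0" and i: "i \<in> E"
    define q where "q b = (\<Sum>x\<in>E. const_poly (c x) * p x b)" for b
    define y where "y = (\<Sum>x\<in>E. const_poly (c x) *s x)"
    have lookup_const_mult: "Poly_Mapping.lookup (const_poly a * r) 0 = a * Poly_Mapping.lookup r 0"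
      for a :: 'k and r :: "('n, 'k) polynomial"
      by (simp flip: mult_map_scale_conv_mult add: Poly_Mapping.map.rep_eq when_def)
    \<comment> \<open>A relation among the reduced vectors \<open>v x\<close> is an R-relation on
      \<open>C\<close> with the constant terms of \<open>q b\<close> as coefficients, so these
      constant terms vanish.\<close>
    have "(\<Sum>b\<in>C. const_poly (Poly_Mapping.lookup (q b) 0) *s b) =
        (\<Sum>b\<in>C. \<Sum>x\<in>E. const_poly (c x * Poly_Mapping.lookup (p x b) 0) *s b)"
      by (simp add: q_def lookup_sum lookup_const_mult kspace.scale_sum_left)
    also have "\<dots> = (\<Sum>x\<in>E. const_poly (c x) *s v x)"
      by (subst sum.swap) (simp add: v_def scale_sum_right mult_single)
    finally have "const_poly (Poly_Mapping.lookup (q b) 0) = (0 :: ('n, 'k) polynomial)" if "b \<in> C" for b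
      using independentD[OF C(2,1) subset_refl, of "\<lambda>b. const_poly (Poly_Mapping.lookup (q b) 0)"]
        that c by simp
    then have q0: "Poly_Mapping.lookup (q b) 0 = 0" if "b \<in> C" for b
      using that by (metis lookup_single_eq lookup_zero)
    \<comment> \<open>Without constant terms, \<open>q b\<close> pushes every element into positive
      degree, whereas \<open>y\<close> is homogeneous of degree 0; hence
      \<open>y = 0\<close>.\<close>
    have "y = (\<Sum>x\<in>E. const_poly (c x) *s (\<Sum>b\<in>C. p x b *s b))"
      unfolding y_def using p by simp
    also have "\<dots> = (\<Sum>b\<in>C. q b *s b)"
      by (simp add: scale_sum_right q_def scale_sum_left) (rule sum.swap)
    also have "\<dots> \<in> kspace.span (act ` (E \<times> {m. total_degree m \<noteq> 0}))"
      by (intro kspace.span_sum scale_mem_kspan_positive[OF E(4)] q0)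
    finally have "y \<in> kspace.span (act ` (E \<times> {m. total_degree m \<noteq> 0}))" .
    moreover have "y \<in> G 0"
      unfolding y_def using E(2)
      by (intro kspace.subspace_sum kspace.subspace_scale subspace_component) auto
    ultimately have "y \<in> kspace.span (act ` (E \<times>
        {m \<in> {m. total_degree m \<noteq> 0}. int (total_degree m) = 0}))"
      by (rule kspan_act_component[OF E(2)])
    moreover have "{m \<in> {m :: 'n \<Rightarrow>\<^sub>0 nat. total_degree m \<noteq> 0}. int (total_degree m) = 0} = {}"
      by auto
    ultimately have "y = 0"
      by (simp only: Sigma_empty2 image_empty kspace.span_empty singleton_iff)
    then show "c i = 0"
      using kspace.independentD[OF E(3,1) subset_refl] i unfolding y_def by blast
  next
    show "v ` E \<subseteq> kspace.span C"
      by (auto simp: v_def intro!: kspace.span_sum intro: kspace.span_scale kspace.span_base)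
  qed (rule C(1))
  also have "\<dots> \<le> card C"
    by (intro kspace.dim_le_card kspace.span_superset C(1))
  finally show ?thesis .
qed

lemma dim_truncation_independent:
  assumes "finite E" and "independent E"
  shows "kspace.dim (truncation E n) = card E * ((n + CARD('n)) choose CARD('n))"
proof (rule antisym)
  have "kspace.dim (truncation E n) \<le> card (truncation E n)"
    using assms(1) by (intro kspace.dim_le_card kspace.span_superset finite_truncation)
  then show "kspace.dim (truncation E n) \<le> card E * ((n + CARD('n)) choose CARD('n))"
    using card_truncation_le[OF assms(1), of n] by simp
  have "(\<Sum>e\<in>E. card {m :: 'n \<Rightarrow>\<^sub>0 nat. total_degree m \<le> n}) \<le> kspace.dim (truncation E n)"
    by (rule card_le_dim_truncation[OF assms(1,1)])
      (use finite_total_degree_le independentD[OF assms(2,1) subset_refl]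
        in \<open>auto simp: truncation_def intro!: kspace.span_base\<close>)
  then show "card E * ((n + CARD('n)) choose CARD('n)) \<le> kspace.dim (truncation E n)"
    by (simp add: card_total_degree_le)
qed

text \<open>In a relation the coefficient of \<open>e\<close> multiplies \<open>e\<close> into
  \<open>span B\<close>; being free of \<open>v\<close>, it vanishes. So the products of
  \<open>e\<close> with monomials in the other variables come on top of those of
  \<open>B\<close>.\<close>

lemma dim_truncation_ge:
  assumes E: "finite E" and B: "B \<subseteq> E" "independent B"
    and e: "e \<in> E" and v: "\<And>s. s *s e \<in> span B \<Longrightarrow>
      (\<And>m. m \<in> Poly_Mapping.keys s \<Longrightarrow> Poly_Mapping.lookup m v = 0) \<Longrightarrow> s = 0"
  shows "card B * ((n + CARD('n)) choose CARD('n)) + ((n + (CARD('n) - 1)) choose (CARD('n) - 1)) \<le>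
    kspace.dim (truncation E n)"
proof -
  have finB: "finite B" using B(1) E finite_subset by blast
  \<comment> \<open>The constant \<open>1\<close> is free of \<open>v\<close> and nonzero, so it
    cannot multiply \<open>e\<close> into the span.\<close>
  have eB: "e \<notin> B" using v[of 1] by (auto simp: span_base)
  define L where "L x = {m. total_degree m \<le> n \<and> (x = e \<longrightarrow> Poly_Mapping.lookup m v = 0)}" for x
  have finL: "finite (L x)" for x
    by (rule finite_subset[OF _ finite_total_degree_le[of n]]) (auto simp: L_def)
  have "(\<Sum>x\<in>insert e B. card (L x)) \<le> kspace.dim (truncation E n)"
  proof (rule card_le_dim_truncation[OF E])
    fix p x
    assume keys: "\<And>x. Poly_Mapping.keys (p x) \<subseteq> L x"
      and sum: "(\<Sum>x\<in>insert e B. p x *s x) = 0" and x: "x \<in> insert e B"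
    have split: "p e *s e + (\<Sum>x\<in>B. p x *s x) = 0" using sum finB eB by simp
    then have "p e *s e = - (\<Sum>x\<in>B. p x *s x)" by (simp add: eq_neg_iff_add_eq_0)
    also have "\<dots> \<in> span B"
      by (intro span_neg span_sum span_scale span_base)
    finally have "p e = 0"
      by (rule v) (use keys[of e] in \<open>auto simp: L_def\<close>)
    then show "p x = 0"
      using split x independentD[OF B(2) finB subset_refl, of p] by auto
  next
    fix x m assume "x \<in> insert e B" "m \<in> L x"
    then show "act (x, m) \<in> kspace.span (truncation E n)"
      using B(1) e by (intro kspace.span_base) (auto simp: truncation_def L_def)
  qed (use finB finL in auto)
  moreover have "card (L x) = (n + CARD('n)) choose CARD('n)" if "x \<in> B" for x
  proof -
    have "x \<noteq> e" using that eB by blast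
    then show ?thesis by (simp add: L_def card_total_degree_le)
  qed
  moreover have "card (L e) = (n + (CARD('n) - 1)) choose (CARD('n) - 1)"
  proof -
    have "L e = monomials_upto (UNIV - {v}) UNIV n"
      by (auto simp: L_def monomials_upto_def in_keys_iff)
    then show ?thesis by (simp add: card_monomials_upto card_Diff_singleton)
  qed
  ultimately show ?thesis using finB eB by (simp add: add.commute)
qed

lemma free_iff_hilbert_coeff_1_eq_0:
  "free \<longleftrightarrow> hilbert_coeff 1 = 0"
proof -
  let ?d = "CARD('n)"
  have d: "?d > 0" by simp
  obtain E where E: "finite E" "E \<subseteq> G 0" "kspace.independent E" "span E = UNIV"
    using ex_finite_component_basis by blast
  note hilbert = cumulative_hilbert_eq_dim[OF E(1,2,4)]
  obtain B where B: "B \<subseteq> E" "independent B"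
      and alg: "\<And>e. e \<in> E \<Longrightarrow> \<exists>a. a \<noteq> 0 \<and> a *s e \<in> span B"
    using ex_maximal_independent_subset[OF E(1)] by blast
  have finB: "finite B" using B(1) E(1) finite_subset by blast
  show ?thesis
  proof
    assume free
    then obtain C where C: "independent C" "span C = UNIV" by (auto simp: free_def)
    have le: "card D \<le> card B" if "finite D" "D \<subseteq> C" for D
      using card_independent_le[OF E(1,4) finB alg that(1)] independent_mono[OF C(1) that(2)] by blast
    have finC: "finite C"
    proof (rule ccontr)
      assume "infinite C"
      then obtain D where "finite D" "card D = Suc (card B)" "D \<subseteq> C"
        using infinite_arbitrarily_large by blast
      then show False using le[of D] by simp
    qed
    \<comment> \<open>The chain \<open>card E \<le> card C \<le> card B\<close> leaves no room for a
      proper subset \<open>B\<close> of \<open>E\<close>.\<close>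
    have "card E \<le> card B"
      using card_component_basis_le[OF E finC C] le[OF finC subset_refl] by simp
    then have "B = E" using B(1) E(1) by (simp add: card_seteq)
    then have dim: "cumulative_hilbert n = card E * ((n + ?d) choose ?d)" for n
      using dim_truncation_independent[OF E(1)] B(2) hilbert by simp
    define e :: "nat \<Rightarrow> int" where "e i = (if i = 0 then int (card E) else 0)" for i
    have "(\<Sum>i\<le>?d. (- 1) ^ i * e i * int ((n + (?d - i)) choose (?d - i))) =
        (\<Sum>i\<le>?d. if i = 0 then int (card E) * int ((n + ?d) choose ?d) else 0)" for n
      by (intro sum.cong) (auto simp: e_def)
    then have "is_hilbert_coeffs e"
      by (simp add: is_hilbert_coeffs_def dim)
    then have "hilbert_coeff = e"
      by (rule hilbert_coeff_eqI) (simp add: e_def)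
    then show "hilbert_coeff 1 = 0" by (simp add: e_def)
  next
    assume e1: "hilbert_coeff 1 = 0"
    define c where "c j = (- 1) ^ (?d - j) * hilbert_coeff (?d - j)" for j
    have c: "\<forall>\<^sub>F n in sequentially. int (cumulative_hilbert n) =
        (\<Sum>j\<le>?d. c j * int ((n + j) choose j))"
      using is_hilbert_coeffs_hilbert_coeff[OF binomial_type_cumulative_hilbert[OF E(1,2,4)]]
      unfolding is_hilbert_coeffs_iff c_def .
    have "E \<subseteq> span B"
    proof (rule ccontr)
      assume "\<not> E \<subseteq> span B"
      then obtain x where x: "x \<in> E" "x \<notin> span B" by blast
      then obtain v where v: "\<And>s. s *s x \<in> span B \<Longrightarrow>
          (\<And>m. m \<in> Poly_Mapping.keys s \<Longrightarrow> Poly_Mapping.lookup m v = 0) \<Longrightarrow> s = 0"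
        using mem_span_if_free_of_each_variable[OF finB B(2), of x] by metis
      have lower: "card B * ((n + ?d) choose ?d) + ((n + (?d - 1)) choose (?d - 1)) \<le>
          cumulative_hilbert n" for n
        unfolding hilbert by (rule dim_truncation_ge[OF E(1) B x(1) v])
      obtain N where upper: "\<And>n. cumulative_hilbert n \<le> card B * ((n + N + ?d) choose ?d)"
        using dim_truncation_le[OF E(1) finB alg] hilbert by auto
      \<comment> \<open>Both bounds carry the factor \<open>card B\<close> and differ only by a
        shift and a lower-order surplus.\<close>
      have "c ?d = int (card B)"
        using c by (rule binomial_sum_leading_coeff) (use lower upper in \<open>auto intro: add_leD1\<close>)
      then have "c (?d - 1) \<ge> 1"
        using binomial_sum_second_coeff_pos[of cumulative_hilbert c "?d - 1" "card B"] c lower d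
        by simp
      \<comment> \<open>This coefficient is \<open>- hilbert_coeff 1\<close>, by the alternating
        sign in the defining formula.\<close>
      moreover have "c (?d - 1) = 0" using e1 d by (simp add: c_def)
      ultimately show False by simp
    qed
    then have "span B = UNIV" using E(4) span_minimal[of E "span B"] by auto
    then show free using B(2) by (auto simp: free_def)
  qed
qed

end

theorem theorem5p3:
  fixes scale :: "('n::finite, 'k::field) polynomial \<Rightarrow> 'm::ab_group_add \<Rightarrow> 'm"
    and G :: "int \<Rightarrow> 'm set"
  assumes "CARD('n) \<ge> 2"
    and "graded_module scale G"
    and "\<exists>x::'m. x \<noteq> 0"
    and "module.finitely_generated scale"
    and "module.span scale (G 0) = UNIV"
    and "module.torsion_free scale"
  shows "module.free scale \<longleftrightarrow> graded_module.hilbert_coeff scale G 1 = 0"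
proof -
  interpret graded_module scale G by fact
  interpret torsion_free_graded_module scale G
    by unfold_locales fact+
  show ?thesis by (rule free_iff_hilbert_coeff_1_eq_0)
qed

end
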